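(* Let $d, D$ be positive integers, and let $E$ be the event that there exists a quasi-isometry between $(\mathbb{Z}^d,\ell^1)$ and some subspace of $(W_p(\mathbb{Z}^D),\ell^1)$. (a) If $d<D$ then for all $p\in(0,1)$ we have $\mathbb{P}_p(E)=1$. (b) If $d\ge D$ then for all $p\in(0,1)$ we have $\mathbb{P}_p(E)=0$.
   Context: Site percolation: each site of $\mathbb{Z}^D$ is declared open with probability $p$ and otherwise closed, independently for different sites. $W_p(\mathbb{Z}^D)$ is the random set of open sites and $\mathbb{P}_p$ is the associated (product) probability measure. $(\mathbb{Z}^d,\ell^1)$ and $(W_p(\mathbb{Z}^D),\ell^1)$ denote the metric spaces with the metric induced by the $\ell^1$-norm. A quasi-isometry between two metric spaces $(X,\delta)$ and $(Y,\rho)$ is a map $f:X\to Y$ such that there exist constants $c_1,\ldots,c_5\in(0,\infty)$ with: (i) for all $x,x'\in X$, $c_1\delta(x,x')-c_2\le\rho(f(x),f(x'))\le c_3\delta(x,x')+c_4$; (ii) for all $y\in Y$ there exists $x\in X$ such that $\rho(f(x),y)\le c_5$. (The existence of a quasi-isometry is a symmetric relation on metric spaces.) A subspace of a metric space $(X,\delta)$ is a metric space $(U,\delta)$ with $U\subseteq X$. *)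

theory Defs
  imports "HOL-Probability.Probability"
begin

definition lattice :: "nat \<Rightarrow> (nat \<Rightarrow> int) set" where
  "lattice n = {..<n} \<rightarrow>\<^sub>E UNIV"

definition l1_dist :: "nat \<Rightarrow> (nat \<Rightarrow> int) \<Rightarrow> (nat \<Rightarrow> int) \<Rightarrow> real" where
  "l1_dist n x y = (\<Sum>i<n. \<bar>real_of_int (x i) - real_of_int (y i)\<bar>)"

definition l1_metric :: "nat \<Rightarrow> (nat \<Rightarrow> int) metric" where
  "l1_metric n = metric (lattice n, l1_dist n)"

lemma Metric_space_lattice: "Metric_space (lattice n) (l1_dist n)"
proof
  show "0 \<le> l1_dist n x y" for x y
    unfolding l1_dist_def by (intro sum_nonneg) auto
  show "l1_dist n x y = l1_dist n y x" for x y
    unfolding l1_dist_def by (intro sum.cong) auto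
  show "l1_dist n x y = 0 \<longleftrightarrow> x = y" if "x \<in> lattice n" "y \<in> lattice n" for x y
  proof
    assume "l1_dist n x y = 0"
    then have "x i = y i" if "i < n" for i
      using that unfolding l1_dist_def by (subst (asm) sum_nonneg_eq_0_iff) auto
    then show "x = y"
      using that unfolding lattice_def by (intro PiE_ext) auto
  qed (simp add: l1_dist_def)
  show "l1_dist n x z \<le> l1_dist n x y + l1_dist n y z" for x y z
    unfolding l1_dist_def sum.distrib [symmetric] by (intro sum_mono) linarith
qed

lemma mspace_l1_metric [simp]: "mspace (l1_metric n) = lattice n"
  by (simp add: l1_metric_def Metric_space.mspace_metric Metric_space_lattice)

lemma mdist_l1_metric [simp]: "mdist (l1_metric n) = l1_dist n"
  by (simp add: l1_metric_def Metric_space.mdist_metric Metric_space_lattice)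

definition quasi_isometry :: "'a metric \<Rightarrow> 'b metric \<Rightarrow> ('a \<Rightarrow> 'b) \<Rightarrow> bool" where
  "quasi_isometry X Y f \<longleftrightarrow>
     f \<in> mspace X \<rightarrow> mspace Y \<and>
     (\<exists>c1 c2 c3 c4 c5 :: real.
        0 < c1 \<and> 0 < c2 \<and> 0 < c3 \<and> 0 < c4 \<and> 0 < c5 \<and>
        (\<forall>x\<in>mspace X. \<forall>x'\<in>mspace X.
           c1 * mdist X x x' - c2 \<le> mdist Y (f x) (f x') \<and>
           mdist Y (f x) (f x') \<le> c3 * mdist X x x' + c4) \<and>
        (\<forall>y\<in>mspace Y. \<exists>x\<in>mspace X. mdist Y (f x) y \<le> c5))"

text \<open>A configuration assigns \<open>True\<close> to the open sites and \<open>False\<close> to the closed ones.\<close>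

definition site_percolation :: "nat \<Rightarrow> real \<Rightarrow> ((nat \<Rightarrow> int) \<Rightarrow> bool) measure" where
  "site_percolation n p = (\<Pi>\<^sub>M x\<in>lattice n. measure_pmf (bernoulli_pmf p))"

definition open_sites :: "nat \<Rightarrow> ((nat \<Rightarrow> int) \<Rightarrow> bool) \<Rightarrow> (nat \<Rightarrow> int) set" where
  "open_sites n \<omega> = {x \<in> lattice n. \<omega> x}"

definition open_metric :: "nat \<Rightarrow> ((nat \<Rightarrow> int) \<Rightarrow> bool) \<Rightarrow> (nat \<Rightarrow> int) metric" where
  "open_metric n \<omega> = submetric (l1_metric n) (open_sites n \<omega>)"

definition qi_event :: "nat \<Rightarrow> nat \<Rightarrow> real \<Rightarrow> ((nat \<Rightarrow> int) \<Rightarrow> bool) set" where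
  "qi_event d D p =
     {\<omega> \<in> space (site_percolation D p).
        \<exists>U f. U \<subseteq> mspace (open_metric D \<omega>) \<and>
          quasi_isometry (l1_metric d) (submetric (open_metric D \<omega>) U) f}"

end

theory Submission
  imports
    "HOL-Library.Transitive_Closure_Table"
    "HOL-Homology.Invariance_of_Domain"
    Defs
begin

text \<open>
  The event \<open>E\<close> says that some map from the \<open>d\<close>-dimensional lattice to the open sites distorts distances
  only by constants (\<open>coarse_embedding\<close>, \<open>qi_event_iff\<close>); a compactness argument makes \<open>E\<close> measurable
  (\<open>qi_event_sets\<close>).

  For \<open>d < D\<close> the map is built from a Lipschitz surface. Group the sites above each point of the
  \<open>d\<close>-dimensional base into columns of length \<open>n\<close>. A column is blocked if all of its sites are closed,
  which has probability \<open>(1 - p) ^ n\<close>, as small as desired. The surface runs just above the highest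
  column that is reached from height 0 by paths that rise only into blocked columns and descend freely
  to neighbours (\<open>lipschitz_surface\<close>). It is finite because long paths need many blocked columns and
  there are only exponentially many paths (\<open>AE_climb_bounded\<close>). Every column on the surface contains an
  open site, and choosing one in each column is a coarse embedding (\<open>coarse_embedding_of_surface\<close>).

  For \<open>d \<ge> D\<close> the obstruction is topological. A coarse embedding restricts to one of the
  \<open>D\<close>-dimensional lattice into itself. Such a map comes within a bounded distance of every point
  (\<open>coarse_self_embedding_coarsely_onto\<close>): otherwise a scaling limit would be a bilipschitz map of
  Euclidean space into itself whose image has a point nearest to the origin at distance 1,
  contradicting invariance of domain. The open sites, however, almost surely leave out balls of every
  radius (\<open>AE_closed_balls\<close>).
\<close>

section \<open>Coarse embeddings\<close>

text \<open>A single constant replaces \<open>c\<^sub>1\<close>, ..., \<open>c\<^sub>4\<close>, and the lower bound is solved for the distance in the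
domain, so that the condition is symmetric and, for distances, only weakens as \<open>k\<close> grows. The constant may then
be taken to be a natural number, which leaves countably many conditions.\<close>

definition comparable_up_to :: "real \<Rightarrow> real \<Rightarrow> real \<Rightarrow> bool" where
  "comparable_up_to k r s \<longleftrightarrow> r \<le> k * s + k \<and> s \<le> k * r + k"

definition coarse_embedding :: "nat \<Rightarrow> nat \<Rightarrow> real \<Rightarrow> ((nat \<Rightarrow> int) \<Rightarrow> (nat \<Rightarrow> int)) \<Rightarrow> bool" where
  "coarse_embedding d D k f \<longleftrightarrow> f \<in> lattice d \<rightarrow> lattice D \<and>
     (\<forall>x\<in>lattice d. \<forall>y\<in>lattice d. comparable_up_to k (l1_dist d x y) (l1_dist D (f x) (f y)))"

lemma l1_dist_nonneg [simp]: "0 \<le> l1_dist n x y"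
  unfolding l1_dist_def by (intro sum_nonneg) auto

lemma l1_dist_self [simp]: "l1_dist n x x = 0"
  by (simp add: l1_dist_def)

lemma comparable_up_to_mono:
  assumes "comparable_up_to k r s" "k \<le> k'" "0 \<le> r" "0 \<le> s"
  shows "comparable_up_to k' r s"
  using assms mult_right_mono[of k k' s] mult_right_mono[of k k' r]
  unfolding comparable_up_to_def by auto

text \<open>Taking the image of \<open>f\<close> as the subspace makes condition (ii) trivial, so only the distance bounds
and the openness of the sites \<open>f x\<close> remain.\<close>

lemma qi_event_iff:
  "\<omega> \<in> qi_event d D p \<longleftrightarrow> \<omega> \<in> space (site_percolation D p) \<and>
     (\<exists>k::nat. \<exists>f. coarse_embedding d D (real k) f \<and> (\<forall>x\<in>lattice d. \<omega> (f x)))"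
  (is "?L \<longleftrightarrow> ?S \<and> ?R")
proof
  assume ?L
  then obtain U f where S: ?S and U: "U \<subseteq> open_sites D \<omega>"
    and f: "quasi_isometry (l1_metric d) (submetric (open_metric D \<omega>) U) f"
    by (auto simp: qi_event_def open_metric_def)
  have sub: "open_sites D \<omega> \<subseteq> lattice D"
    by (auto simp: open_sites_def)
  have ms: "mspace (submetric (open_metric D \<omega>) U) = U"
    using U sub by (auto simp: open_metric_def)
  have md: "mdist (submetric (open_metric D \<omega>) U) = l1_dist D"
    by (simp add: open_metric_def)
  from f obtain c1 c2 c3 c4 :: real where c: "0 < c1" "0 < c2" "0 < c3" "0 < c4"
    and b: "\<And>x y. x \<in> lattice d \<Longrightarrow> y \<in> lattice d \<Longrightarrow>
       c1 * l1_dist d x y - c2 \<le> l1_dist D (f x) (f y) \<and> l1_dist D (f x) (f y) \<le> c3 * l1_dist d x y + c4"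
    and fU: "f \<in> lattice d \<rightarrow> U"
    unfolding quasi_isometry_def ms md by auto
  obtain k :: nat where k: "real k \<ge> Max {1 / c1, c2 / c1, c3, c4}"
    using real_arch_simple by blast
  then have k': "1 / c1 \<le> k" "c2 / c1 \<le> k" "c3 \<le> k" "c4 \<le> k"
    by auto
  have "comparable_up_to k (l1_dist d x y) (l1_dist D (f x) (f y))"
    if "x \<in> lattice d" "y \<in> lattice d" for x y
  proof -
    let ?r = "l1_dist d x y" and ?s = "l1_dist D (f x) (f y)"
    have "?r \<le> 1 / c1 * ?s + c2 / c1"
      using b[OF that] c by (simp add: field_simps)
    also have "\<dots> \<le> k * ?s + k"
      using k' by (intro add_mono mult_right_mono) auto
    finally have "?r \<le> k * ?s + k" .
    moreover have "c3 * ?r + c4 \<le> k * ?r + k"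
      using k' by (intro add_mono mult_right_mono) auto
    ultimately show ?thesis
      using b[OF that] unfolding comparable_up_to_def by linarith
  qed
  moreover have "f x \<in> lattice D \<and> \<omega> (f x)" if "x \<in> lattice d" for x
    using fU U that by (auto simp: open_sites_def)
  ultimately have "coarse_embedding d D k f \<and> (\<forall>x\<in>lattice d. \<omega> (f x))"
    by (auto simp: coarse_embedding_def)
  with S show "?S \<and> ?R" by blast
next
  assume "?S \<and> ?R"
  then obtain k :: nat and f where S: ?S and f: "coarse_embedding d D k f"
    and op: "\<And>x. x \<in> lattice d \<Longrightarrow> \<omega> (f x)" by blast
  define U where "U = f ` lattice d"
  have U: "U \<subseteq> open_sites D \<omega>"
    using f op by (auto simp: U_def open_sites_def coarse_embedding_def)
  have sub: "open_sites D \<omega> \<subseteq> lattice D"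
    by (auto simp: open_sites_def)
  have ms: "mspace (submetric (open_metric D \<omega>) U) = U"
    using U sub by (auto simp: open_metric_def)
  have md: "mdist (submetric (open_metric D \<omega>) U) = l1_dist D"
    by (simp add: open_metric_def)
  have b: "1 / (k + 1) * l1_dist d x y - 1 \<le> l1_dist D (f x) (f y)
      \<and> l1_dist D (f x) (f y) \<le> (k + 1) * l1_dist d x y + (k + 1)"
    if "x \<in> lattice d" "y \<in> lattice d" for x y
  proof -
    have "comparable_up_to (k + 1) (l1_dist d x y) (l1_dist D (f x) (f y))"
    proof (rule comparable_up_to_mono)
      show "comparable_up_to k (l1_dist d x y) (l1_dist D (f x) (f y))"
        using f that by (simp add: coarse_embedding_def)
    qed simp_all
    then have "l1_dist d x y \<le> (k + 1) * (l1_dist D (f x) (f y) + 1)"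
      and "l1_dist D (f x) (f y) \<le> (k + 1) * l1_dist d x y + (k + 1)"
      by (simp_all add: comparable_up_to_def distrib_left)
    moreover from this(1) have "1 / (k + 1) * l1_dist d x y \<le> l1_dist D (f x) (f y) + 1"
      by (simp add: divide_le_eq mult.commute)
    ultimately show ?thesis by simp
  qed
  have "quasi_isometry (l1_metric d) (submetric (open_metric D \<omega>) U) f"
    unfolding quasi_isometry_def ms md
  proof (intro conjI exI ballI)
    show "f \<in> mspace (l1_metric d) \<rightarrow> U" by (simp add: U_def)
    fix y assume "y \<in> U"
    then obtain x where "x \<in> lattice d" "y = f x" by (auto simp: U_def)
    then show "\<exists>x\<in>mspace (l1_metric d). l1_dist D (f x) y \<le> 1"
      by (intro bexI[of _ x]) simp_all
  next
    fix x y assume "x \<in> mspace (l1_metric d)" "y \<in> mspace (l1_metric d)"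
    then show "1 / (real k + 1) * mdist (l1_metric d) x y - 1 \<le> l1_dist D (f x) (f y)"
      "l1_dist D (f x) (f y) \<le> (real k + 1) * mdist (l1_metric d) x y + (real k + 1)"
      using b[of x y] by (simp_all add: add.commute)
  qed auto
  with S U sub show ?L
    unfolding qi_event_def by (auto simp: open_metric_def)
qed

section \<open>Measurability of the event\<close>

text \<open>Tychonoff's theorem: the selections form a compact product of finite discrete spaces, and the
constraint for a pair \<open>(x, y)\<close> cuts out a closed set because it involves two coordinates only.\<close>

lemma pairwise_selection_compactness:
  assumes fin: "\<And>x. x \<in> X \<Longrightarrow> finite (B x)"
    and loc: "\<And>T. finite T \<Longrightarrow> T \<subseteq> X \<Longrightarrow> \<exists>f\<in>Pi\<^sub>E T B. \<forall>x\<in>T. \<forall>y\<in>T. R x y (f x) (f y)"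
  shows "\<exists>f\<in>Pi\<^sub>E X B. \<forall>x\<in>X. \<forall>y\<in>X. R x y (f x) (f y)"
proof -
  let ?P = "product_topology (\<lambda>x. discrete_topology (B x)) X"
  let ?C = "\<lambda>x y. {f \<in> Pi\<^sub>E X B. R x y (f x) (f y)}"
  have comp: "compact_space ?P"
    using fin by (auto simp: compact_space_product_topology compact_space_discrete_topology)
  have eval: "closedin ?P {f \<in> Pi\<^sub>E X B. f x \<in> A}" if "x \<in> X" "A \<subseteq> B x" for x A
    using closedin_continuous_map_preimage
        [OF continuous_map_product_projection[OF that(1), of "\<lambda>x. discrete_topology (B x)"], of A] that
    by simp
  have closed: "closedin ?P (?C x y)" if xy: "x \<in> X" "y \<in> X" for x y
  proof -
    have "?C x y = (\<Union>b\<in>B x. {f \<in> Pi\<^sub>E X B. f x \<in> {b}} \<inter> {f \<in> Pi\<^sub>E X B. f y \<in> {c \<in> B y. R x y b c}})"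
      using xy by (auto simp: PiE_mem)
    moreover have "closedin ?P ({f \<in> Pi\<^sub>E X B. f x \<in> {b}} \<inter> {f \<in> Pi\<^sub>E X B. f y \<in> {c \<in> B y. R x y b c}})"
      if "b \<in> B x" for b
      using that xy by (intro closedin_Int eval) simp_all
    then have "closedin ?P (\<Union>b\<in>B x. {f \<in> Pi\<^sub>E X B. f x \<in> {b}} \<inter> {f \<in> Pi\<^sub>E X B. f y \<in> {c \<in> B y. R x y b c}})"
      using fin[OF xy(1)] by (intro closedin_Union) auto
    ultimately show ?thesis by (simp only:)
  qed
  show ?thesis
  proof (cases "X = {}")
    case False
    let ?\<U> = "(\<lambda>(x, y). ?C x y) ` (X \<times> X)"
    have "\<Inter>\<F> \<noteq> {}" if F: "finite \<F>" "\<F> \<subseteq> ?\<U>" for \<F>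
    proof -
      obtain P where P: "finite P" "P \<subseteq> X \<times> X" "\<F> = (\<lambda>(x, y). ?C x y) ` P"
        using finite_subset_image[OF F] by blast
      define T where "T = fst ` P \<union> snd ` P"
      obtain f where f: "f \<in> Pi\<^sub>E T B" "\<forall>x\<in>T. \<forall>y\<in>T. R x y (f x) (f y)"
        using loc[of T] P by (fastforce simp: T_def)
      have ne: "B x \<noteq> {}" if "x \<in> X" for x
      proof -
        from that have "\<exists>f. f \<in> Pi\<^sub>E {x} B" using loc[of "{x}"] by blast
        then show ?thesis using PiE_mem[of _ "{x}" B x] by blast
      qed
      define g where "g x = (if x \<in> T then f x else if x \<in> X then SOME b. b \<in> B x else undefined)" for x
      have "T \<subseteq> X" using P(2) by (auto simp: T_def)
      then have "g \<in> Pi\<^sub>E X B"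
        using f(1) ne by (auto simp: g_def PiE_iff some_in_eq extensional_def)
      moreover have "R x y (g x) (g y)" if "(x, y) \<in> P" for x y
      proof -
        from that have "x \<in> T" "y \<in> T" by (force simp: T_def)+
        with f(2) show ?thesis by (simp add: g_def)
      qed
      ultimately have "g \<in> \<Inter>\<F>"
        unfolding P(3) by (simp add: split_beta)
      then show ?thesis by blast
    qed
    moreover have "\<forall>C\<in>?\<U>. closedin ?P C"
      using closed by auto
    ultimately have "\<Inter>?\<U> \<noteq> {}"
      using comp[unfolded compact_space_fip, THEN spec[of _ ?\<U>]] by simp
    then obtain f where "f \<in> \<Inter>?\<U>" by blast
    then have "f \<in> ?C x y" if "x \<in> X" "y \<in> X" for x y
      using that by simp
    with False show ?thesis by blast
  qed auto
qed

lemma countable_lattice: "countable (lattice n)"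
  unfolding lattice_def by (rule countable_PiE) auto

lemma finite_lattice_ball: "finite {y \<in> lattice n. l1_dist n a y \<le> r}"
proof (rule finite_subset)
  let ?N = "\<lambda>i. {a i - \<lceil>r\<rceil>..a i + \<lceil>r\<rceil>}"
  show "{y \<in> lattice n. l1_dist n a y \<le> r} \<subseteq> Pi\<^sub>E {..<n} ?N"
  proof clarsimp
    fix y assume y: "y \<in> lattice n" "l1_dist n a y \<le> r"
    have "\<bar>a i - y i\<bar> \<le> \<lceil>r\<rceil>" if "i < n" for i
    proof -
      have "\<bar>real_of_int (a i) - real_of_int (y i)\<bar> \<le> l1_dist n a y"
        unfolding l1_dist_def using that by (intro member_le_sum) auto
      then have "real_of_int \<bar>a i - y i\<bar> \<le> r"
        using y(2) by simp
      then show ?thesis by linarith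
    qed
    then have "y i \<in> ?N i" if "i < n" for i
      using that by (simp add: abs_le_iff algebra_simps)
    then show "y \<in> Pi\<^sub>E {..<n} ?N"
      using y(1) by (simp add: lattice_def PiE_iff)
  qed
qed (intro finite_PiE; simp)

lemma measurable_site:
  "x \<in> lattice D \<Longrightarrow> Measurable.pred (site_percolation D p) (\<lambda>\<omega>. \<omega> x)"
  unfolding site_percolation_def
  using measurable_component_singleton[of x "lattice D" "\<lambda>_. measure_pmf (bernoulli_pmf p)"]
  by simp

lemma lattice_nonempty: "\<exists>x. x \<in> lattice d"
  unfolding lattice_def by (rule exI[of _ "restrict (\<lambda>_. 0) {..<d}"]) simp

text \<open>The existence of \<open>f\<close> is an uncountable union of events. Fixing the constant \<open>k\<close> and the value of \<open>f\<close> at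
one base point confines each \<open>f x\<close> to a finite ball, so by compactness \<open>f\<close> exists if and only if
every finite set of points admits a partial solution. The latter is a finite union of cylinders,
and there are countably many choices of \<open>k\<close>, of the value at the base point and of the finite set.\<close>

lemma qi_event_sets: "qi_event d D p \<in> sets (site_percolation D p)"
proof -
  obtain o\<^sub>d where o: "o\<^sub>d \<in> lattice d"
    using lattice_nonempty by blast
  define B where "B k a x = {y \<in> lattice D. l1_dist D a y \<le> real k * l1_dist d o\<^sub>d x + real k}" for k a x
  define F where "F k a T = {f \<in> Pi\<^sub>E T (B k a). \<forall>x\<in>T. \<forall>y\<in>T.
      comparable_up_to (real k) (l1_dist d x y) (l1_dist D (f x) (f y))}" for k a T
  have eq: "qi_event d D p = {\<omega> \<in> space (site_percolation D p).
     \<exists>k::nat. \<exists>a\<in>lattice D. \<forall>T\<in>{T. finite T \<and> T \<subseteq> lattice d}. \<exists>f\<in>F k a T. \<forall>x\<in>T. \<omega> (f x)}"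
    (is "_ = {\<omega> \<in> _. \<exists>k. ?Q k \<omega>}")
  proof (intro Set.set_eqI iffI)
    fix \<omega> assume "\<omega> \<in> qi_event d D p"
    then obtain k :: nat and f where S: "\<omega> \<in> space (site_percolation D p)"
      and f: "coarse_embedding d D k f" and op: "\<And>x. x \<in> lattice d \<Longrightarrow> \<omega> (f x)"
      unfolding qi_event_iff by blast
    have "?Q k \<omega>"
    proof (intro bexI ballI)
      show "f o\<^sub>d \<in> lattice D" using f o by (auto simp: coarse_embedding_def)
    next
      fix T assume T: "T \<in> {T. finite T \<and> T \<subseteq> lattice d}"
      then have [simp]: "x \<in> T \<Longrightarrow> x \<in> lattice d" for x by blast
      show "restrict f T \<in> F k (f o\<^sub>d) T"
        using f o by (auto simp: F_def B_def coarse_embedding_def comparable_up_to_def)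
      show "\<omega> (restrict f T x)" if "x \<in> T" for x
        using op that by simp
    qed
    with S show "\<omega> \<in> {\<omega> \<in> space (site_percolation D p). \<exists>k. ?Q k \<omega>}" by blast
  next
    fix \<omega> assume "\<omega> \<in> {\<omega> \<in> space (site_percolation D p). \<exists>k. ?Q k \<omega>}"
    then obtain k a where S: "\<omega> \<in> space (site_percolation D p)"
      and Q: "\<And>T. finite T \<Longrightarrow> T \<subseteq> lattice d \<Longrightarrow> \<exists>f\<in>F k a T. \<forall>x\<in>T. \<omega> (f x)" by blast
    have "\<exists>f\<in>Pi\<^sub>E (lattice d) (B k a). \<forall>x\<in>lattice d. \<forall>y\<in>lattice d.
        comparable_up_to k (l1_dist d x y) (l1_dist D (f x) (f y)) \<and> \<omega> (f x)"
    proof (rule pairwise_selection_compactness)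
      show "finite (B k a x)" for x
        unfolding B_def by (rule finite_lattice_ball)
      show "\<exists>f\<in>Pi\<^sub>E T (B k a). \<forall>x\<in>T. \<forall>y\<in>T.
          comparable_up_to k (l1_dist d x y) (l1_dist D (f x) (f y)) \<and> \<omega> (f x)"
        if "finite T" "T \<subseteq> lattice d" for T
        using Q[OF that] unfolding F_def by blast
    qed
    then obtain f where f: "f \<in> Pi\<^sub>E (lattice d) (B k a)"
      "\<forall>x\<in>lattice d. \<forall>y\<in>lattice d.
        comparable_up_to k (l1_dist d x y) (l1_dist D (f x) (f y)) \<and> \<omega> (f x)" by blast
    have "f x \<in> lattice D" if "x \<in> lattice d" for x
      using PiE_mem[OF f(1) that] by (simp add: B_def)
    with f(2) have "coarse_embedding d D k f \<and> (\<forall>x\<in>lattice d. \<omega> (f x))"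
      unfolding coarse_embedding_def by blast
    with S show "\<omega> \<in> qi_event d D p"
      unfolding qi_event_iff by blast
  qed
  let ?M = "site_percolation D p"
  have "{\<omega> \<in> space ?M. \<exists>f\<in>F k a T. \<forall>x\<in>T. \<omega> (f x)} \<in> sets ?M"
    if T: "finite T" "T \<subseteq> lattice d" for k a T
  proof -
    have "finite (Pi\<^sub>E T (B k a))"
      using T unfolding B_def by (intro finite_PiE finite_lattice_ball) auto
    then have F: "finite (F k a T)"
      unfolding F_def by auto
    have f: "f x \<in> lattice D" if "f \<in> F k a T" "x \<in> T" for f x
      using that by (auto simp: F_def B_def)
    have "{\<omega> \<in> space ?M. \<omega> (f x)} \<in> sets ?M" if "f \<in> F k a T" "x \<in> T" for f x
      using measurable_site[OF f[OF that]] by (simp add: pred_def)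
    then have "{\<omega> \<in> space ?M. \<forall>x\<in>T. \<omega> (f x)} \<in> sets ?M" if "f \<in> F k a T" for f
      by (rule sets.sets_Collect_finite_All[OF _ T(1)]) (rule that)
    then show ?thesis
      by (rule sets.sets_Collect_finite_Ex[OF _ F])
  qed
  note cylinder = this
  have all_boxes: "{\<omega> \<in> space ?M. \<forall>T\<in>{T. finite T \<and> T \<subseteq> lattice d}.
      \<exists>f\<in>F k a T. \<forall>x\<in>T. \<omega> (f x)} \<in> sets ?M" for k a
    by (rule sets.sets_Collect_countable_All'
        [OF _ countable_Collect_finite_subset[OF countable_lattice]], rule cylinder) simp_all
  have "{\<omega> \<in> space ?M. ?Q k \<omega>} \<in> sets ?M" for k
    by (rule sets.sets_Collect_countable_Ex'[OF _ countable_lattice], rule all_boxes)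
  note level = this
  have "{\<omega> \<in> space ?M. \<exists>k. ?Q k \<omega>} \<in> sets ?M"
    by (rule sets.sets_Collect_countable_Ex, rule level)
  then show ?thesis unfolding eq .
qed

section \<open>Probabilities of closed sets, and large closed balls\<close>

lemma prob_space_site_percolation: "prob_space (site_percolation D p)"
  unfolding site_percolation_def by (intro prob_space_PiM prob_space_measure_pmf)

lemma sets_all_closed:
  assumes "finite S" "S \<subseteq> lattice D"
  shows "{\<omega> \<in> space (site_percolation D p). \<forall>x\<in>S. \<not> \<omega> x} \<in> sets (site_percolation D p)"
proof (rule sets.sets_Collect_finite_All[OF _ assms(1)], rule sets.sets_Collect_neg)
  fix x assume "x \<in> S"
  then show "{\<omega> \<in> space (site_percolation D p). \<omega> x} \<in> sets (site_percolation D p)"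
    using measurable_site[of x D p] assms(2) by (auto simp: pred_def)
qed

lemma sets_some_open:
  assumes "finite S" "S \<subseteq> lattice D"
  shows "{\<omega> \<in> space (site_percolation D p). \<exists>x\<in>S. \<omega> x} \<in> sets (site_percolation D p)"
proof (rule sets.sets_Collect_finite_Ex[OF _ assms(1)])
  fix x assume "x \<in> S"
  then show "{\<omega> \<in> space (site_percolation D p). \<omega> x} \<in> sets (site_percolation D p)"
    using measurable_site[of x D p] assms(2) by (auto simp: pred_def)
qed

lemma prob_all_closed:
  assumes p: "0 \<le> p" "p \<le> 1" and S: "finite S" "S \<subseteq> lattice D"
  shows "measure (site_percolation D p) {\<omega> \<in> space (site_percolation D p). \<forall>x\<in>S. \<not> \<omega> x} = (1 - p) ^ card S"
proof -
  interpret product_prob_space "\<lambda>_::nat \<Rightarrow> int. measure_pmf (bernoulli_pmf p)" "lattice D"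
    by unfold_locales
  have "emeasure (site_percolation D p) {\<omega> \<in> space (site_percolation D p). \<forall>x\<in>S. \<omega> x \<in> {False}}
      = (\<Prod>x\<in>S. emeasure (measure_pmf (bernoulli_pmf p)) {False})"
    unfolding site_percolation_def by (rule emeasure_PiM_Collect) (use S in auto)
  also have "\<dots> = ennreal ((1 - p) ^ card S)"
    using p by (simp add: emeasure_pmf_single ennreal_power)
  finally show ?thesis
    using p by (simp add: measure_def)
qed

text \<open>Adding one more set \<open>B m\<close> removes from the event those configurations in which \<open>B m\<close> is closed as
well, and that is the same kind of event with \<open>S \<union> B m\<close> in place of \<open>S\<close>. Carrying the closed set \<open>S\<close>
through the induction thus reduces independence of the blocks to the formula for one closed set.\<close>

lemma prob_some_open_in_each:
  fixes B :: "nat \<Rightarrow> (nat \<Rightarrow> int) set"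
  assumes p: "0 \<le> p" "p \<le> 1"
    and B: "\<And>j. finite (B j)" "\<And>j. B j \<subseteq> lattice D" "disjoint_family B"
    and S: "finite S" "S \<subseteq> lattice D" "\<And>j. j < m \<Longrightarrow> S \<inter> B j = {}"
  defines "M \<equiv> site_percolation D p"
  shows "{\<omega> \<in> space M. (\<forall>x\<in>S. \<not> \<omega> x) \<and> (\<forall>j<m. \<exists>x\<in>B j. \<omega> x)} \<in> sets M \<and>
    measure M {\<omega> \<in> space M. (\<forall>x\<in>S. \<not> \<omega> x) \<and> (\<forall>j<m. \<exists>x\<in>B j. \<omega> x)}
      = (1 - p) ^ card S * (\<Prod>j<m. 1 - (1 - p) ^ card (B j))"
  using S
proof (induction m arbitrary: S)
  case 0
  then show ?case
    using sets_all_closed[of S D p] prob_all_closed[OF p, of S D] by (simp add: M_def)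
next
  case (Suc m)
  interpret prob_space M
    unfolding M_def by (rule prob_space_site_percolation)
  let ?E = "\<lambda>S. {\<omega> \<in> space M. (\<forall>x\<in>S. \<not> \<omega> x) \<and> (\<forall>j<m. \<exists>x\<in>B j. \<omega> x)}"
  have dis: "B m \<inter> B j = {}" if "j < m" for j
    using B(3) that by (auto simp: disjoint_family_on_def)
  have IH1: "?E S \<in> sets M" "measure M (?E S) = (1 - p) ^ card S * (\<Prod>j<m. 1 - (1 - p) ^ card (B j))"
    using Suc.IH[of S] Suc.prems by auto
  have "(S \<union> B m) \<inter> B j = {}" if "j < m" for j
    using dis[OF that] Suc.prems(3)[of j] that by auto
  moreover have "card (S \<union> B m) = card S + card (B m)"
    using Suc.prems B(1) by (intro card_Un_disjoint) auto
  ultimately have IH2: "?E (S \<union> B m) \<in> sets M"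
    "measure M (?E (S \<union> B m)) = (1 - p) ^ card S * (1 - p) ^ card (B m) * (\<Prod>j<m. 1 - (1 - p) ^ card (B j))"
    using Suc.IH[of "S \<union> B m"] Suc.prems B by (simp_all add: power_add)
  have eq: "{\<omega> \<in> space M. (\<forall>x\<in>S. \<not> \<omega> x) \<and> (\<forall>j<Suc m. \<exists>x\<in>B j. \<omega> x)} = ?E S - ?E (S \<union> B m)"
    by (auto simp: less_Suc_eq)
  have "?E (S \<union> B m) \<subseteq> ?E S" by auto
  then have "measure M (?E S - ?E (S \<union> B m)) = measure M (?E S) - measure M (?E (S \<union> B m))"
    by (rule finite_measure_Diff[OF IH1(1) IH2(1)])
  then show ?case
    unfolding eq using IH1 IH2 by (simp add: algebra_simps)
qed

lemma component_le_l1_dist: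
  assumes "l1_dist n x y \<le> real_of_int r" and "i < n"
  shows "\<bar>x i - y i\<bar> \<le> r"
proof -
  have "\<bar>real_of_int (x i) - real_of_int (y i)\<bar> \<le> l1_dist n x y"
    unfolding l1_dist_def using assms(2) by (intro member_le_sum) auto
  with assms(1) have "real_of_int \<bar>x i - y i\<bar> \<le> real_of_int r" by simp
  then show ?thesis by linarith
qed

text \<open>Balls of radius \<open>R\<close> around far apart points of an axis are disjoint and have boundedly many sites,
so each is closed with probability at least some \<open>q > 0\<close>, independently of the others. Almost
surely one of them is closed.\<close>

lemma AE_closed_balls:
  assumes p: "0 < p" "p < 1" and D: "0 < D"
  shows "AE \<omega> in site_percolation D p.
    \<forall>R::nat. \<exists>y\<in>lattice D. \<forall>x\<in>lattice D. l1_dist D y x \<le> real R \<longrightarrow> \<not> \<omega> x"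
proof (subst AE_all_countable, rule allI)
  fix R :: nat
  let ?M = "site_percolation D p"
  interpret prob_space ?M
    by (rule prob_space_site_percolation)
  \<comment> \<open>consecutive centres are at distance \<open>2 * R + 1\<close>, just enough for disjoint balls\<close>
  define c where "c j = (\<lambda>i\<in>{..<D}. if i = 0 then int j * (2 * int R + 1) else 0)" for j :: nat
  define B where "B j = {x \<in> lattice D. l1_dist D (c j) x \<le> real R}" for j
  have fin: "finite (B j)" for j
    unfolding B_def by (rule finite_lattice_ball)
  have sub: "B j \<subseteq> lattice D" for j
    by (auto simp: B_def)
  have c: "c j \<in> lattice D" for j
    by (simp add: c_def lattice_def)
  have disj: "disjoint_family B"
    unfolding disjoint_family_on_def
  proof (intro ballI impI)
    fix j j' :: nat assume "j \<noteq> j'"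
    show "B j \<inter> B j' = {}"
    proof (rule equals0I)
      fix x assume "x \<in> B j \<inter> B j'"
      then have "\<bar>c j 0 - x 0\<bar> \<le> int R" "\<bar>c j' 0 - x 0\<bar> \<le> int R"
        using D by (auto simp: B_def intro!: component_le_l1_dist)
      then have close: "\<bar>(int j - int j') * (2 * int R + 1)\<bar> \<le> 2 * int R"
        using D by (simp add: c_def left_diff_distrib)
      have "1 * (2 * int R + 1) \<le> \<bar>int j - int j'\<bar> * (2 * int R + 1)"
        using \<open>j \<noteq> j'\<close> by (intro mult_right_mono) auto
      also have "\<dots> = \<bar>(int j - int j') * (2 * int R + 1)\<bar>"
        by (simp add: abs_mult)
      also note close
      finally show False by simp
    qed
  qed
  have card: "card (B j) \<le> card (B 0)" for j
  proof -
    have "B j \<subseteq> (\<lambda>x. \<lambda>i\<in>{..<D}. x i + c j i) ` B 0"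
    proof
      fix x assume x: "x \<in> B j"
      define z where "z = (\<lambda>i\<in>{..<D}. x i - c j i)"
      have "l1_dist D (c 0) z = l1_dist D (c j) x"
        unfolding l1_dist_def by (intro sum.cong) (auto simp: z_def c_def)
      then have "z \<in> B 0"
        using x by (simp add: B_def z_def lattice_def)
      moreover have "x = (\<lambda>i\<in>{..<D}. z i + c j i)"
        using x by (auto simp: z_def B_def lattice_def PiE_iff extensional_def fun_eq_iff)
      ultimately show "x \<in> (\<lambda>x. \<lambda>i\<in>{..<D}. x i + c j i) ` B 0" by blast
    qed
    then show ?thesis
      using fin by (rule surj_card_le[rotated])
  qed
  define q where "q = (1 - p) ^ card (B 0)"
  have q: "0 < q" "q \<le> 1"
    using p by (auto simp: q_def power_le_one)
  define N where "N = {\<omega> \<in> space ?M. \<forall>j. \<exists>x\<in>B j. \<omega> x}"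
  have N: "N \<in> sets ?M"
    unfolding N_def by (intro sets.sets_Collect_countable_All sets_some_open fin sub)
  have "measure ?M N \<le> (1 - q) ^ m" for m
  proof -
    let ?E = "{\<omega> \<in> space ?M. (\<forall>x\<in>{}. \<not> \<omega> x) \<and> (\<forall>j<m. \<exists>x\<in>B j. \<omega> x)}"
    have E: "?E \<in> sets ?M \<and>
        measure ?M ?E = (1 - p) ^ card ({} :: (nat \<Rightarrow> int) set) * (\<Prod>j<m. 1 - (1 - p) ^ card (B j))"
      by (rule prob_some_open_in_each) (use p in \<open>simp_all add: fin sub disj\<close>)
    have "N \<subseteq> ?E"
      unfolding N_def by blast
    then have "measure ?M N \<le> measure ?M ?E"
      by (rule finite_measure_mono[OF _ conjunct1[OF E]])
    also note conjunct2[OF E]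
    also have "(1 - p) ^ card ({} :: (nat \<Rightarrow> int) set) * (\<Prod>j<m. 1 - (1 - p) ^ card (B j))
        = (\<Prod>j<m. 1 - (1 - p) ^ card (B j))"
      by simp
    also have "\<dots> \<le> (\<Prod>j<m. 1 - q)"
      unfolding q_def using p card
      by (intro prod_mono conjI diff_left_mono power_decreasing) (auto simp: power_le_one)
    finally show ?thesis by simp
  qed
  moreover have "(\<lambda>m. (1 - q) ^ m) \<longlonglongrightarrow> 0"
    using q by (intro LIMSEQ_power_zero) auto
  ultimately have "measure ?M N \<le> 0"
    by (intro LIMSEQ_le_const) auto
  then have "N \<in> null_sets ?M"
    using N measure_nonneg[of ?M N] by (intro null_setsI) (auto simp: emeasure_eq_measure)
  then show "AE \<omega> in ?M. \<exists>y\<in>lattice D. \<forall>x\<in>lattice D. l1_dist D y x \<le> real R \<longrightarrow> \<not> \<omega> x"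
  proof (rule AE_I')
    show "{\<omega> \<in> space ?M. \<not> (\<exists>y\<in>lattice D. \<forall>x\<in>lattice D. l1_dist D y x \<le> real R \<longrightarrow> \<not> \<omega> x)} \<subseteq> N"
      using c unfolding N_def B_def by blast
  qed
qed

section \<open>Lipschitz surfaces that avoid a set of cells\<close>

text \<open>A cell is a position in the base lattice together with a height. In the application it stands for
a vertical column of sites.\<close>

type_synonym cell = "(nat \<Rightarrow> int) \<times> int"

text \<open>The neighbours in the supremum norm, the point itself included, as translates of one finite set:
this bounds their number uniformly.\<close>

definition nbrs :: "nat \<Rightarrow> (nat \<Rightarrow> int) \<Rightarrow> (nat \<Rightarrow> int) set" where
  "nbrs d u = (\<lambda>\<delta>. \<lambda>i\<in>{..<d}. u i + \<delta> i) ` ({..<d} \<rightarrow>\<^sub>E {-1..1})"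

lemma nbrs_iff:
  assumes "u \<in> lattice d" "v \<in> lattice d"
  shows "v \<in> nbrs d u \<longleftrightarrow> (\<forall>i<d. \<bar>v i - u i\<bar> \<le> 1)"
proof
  assume "v \<in> nbrs d u"
  then obtain \<delta> where \<delta>: "\<delta> \<in> {..<d} \<rightarrow>\<^sub>E {-1..1}" "v = (\<lambda>i\<in>{..<d}. u i + \<delta> i)"
    unfolding nbrs_def by blast
  show "\<forall>i<d. \<bar>v i - u i\<bar> \<le> 1"
  proof (intro allI impI)
    fix i assume "i < d"
    then show "\<bar>v i - u i\<bar> \<le> 1"
      using PiE_mem[OF \<delta>(1), of i] by (simp add: \<delta>(2) abs_le_iff)
  qed
next
  assume *: "\<forall>i<d. \<bar>v i - u i\<bar> \<le> 1"
  have "(\<lambda>i\<in>{..<d}. v i - u i) \<in> {..<d} \<rightarrow>\<^sub>E {-1..1}"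
  proof (rule PiE_I)
    fix i assume "i \<in> {..<d}"
    then show "(\<lambda>i\<in>{..<d}. v i - u i) i \<in> {-1..1}"
      using *[rule_format, of i] by (auto simp: abs_le_iff)
  qed simp
  moreover have "v = (\<lambda>i\<in>{..<d}. u i + (\<lambda>i\<in>{..<d}. v i - u i) i)"
    using assms(2) by (auto simp: lattice_def PiE_iff extensional_def fun_eq_iff)
  ultimately show "v \<in> nbrs d u"
    unfolding nbrs_def by blast
qed

lemma finite_nbrs: "finite (nbrs d u)"
  unfolding nbrs_def by (intro finite_imageI finite_PiE) auto

lemma card_nbrs: "card (nbrs d u) \<le> 3 ^ d"
proof -
  have "card (nbrs d u) \<le> card ({..<d} \<rightarrow>\<^sub>E {-1..1::int})"
    unfolding nbrs_def by (intro card_image_le finite_PiE) auto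
  also have "\<dots> = 3 ^ d"
    by (simp add: card_PiE)
  finally show ?thesis .
qed

text \<open>A climbing path may rise by one only into a cell of \<open>B\<close>, and may descend by one for free while
moving to a neighbouring base point.\<close>

definition climb :: "nat \<Rightarrow> cell set \<Rightarrow> cell \<Rightarrow> cell \<Rightarrow> bool" where
  "climb d B x y \<longleftrightarrow> fst x \<in> lattice d \<and> fst y \<in> lattice d \<and>
     (fst x = fst y \<and> snd y = snd x + 1 \<and> y \<in> B \<or> fst x \<in> nbrs d (fst y) \<and> snd y = snd x - 1)"

lemma greatest_int:
  fixes P :: "int \<Rightarrow> bool"
  assumes "P a" "\<And>h. P h \<Longrightarrow> h \<le> H"
  shows "\<exists>m. P m \<and> (\<forall>h. P h \<longrightarrow> h \<le> m)"
proof -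
  let ?S = "{h \<in> {a..H}. P h}"
  have fin: "finite ?S"
    by (rule finite_subset[of _ "{a..H}"]) auto
  have "a \<in> ?S" using assms by auto
  then have M: "Max ?S \<in> ?S"
    using fin by (intro Max_in) auto
  have "h \<le> Max ?S" if "P h" for h
  proof (cases "a \<le> h")
    case True
    then show ?thesis using that assms fin by (intro Max_ge) auto
  next
    case False
    then show ?thesis using M by auto
  qed
  with M show ?thesis by blast
qed

text \<open>The surface is placed just above the highest cell that can be reached from height 0. The cell on the
surface is not in \<open>B\<close>, because a path could otherwise climb into it; neighbouring values differ by at
most one, because a path that reaches the top above \<open>u\<close> can descend by one to any neighbour of \<open>u\<close>.\<close>

lemma lipschitz_surface:
  assumes bounded: "\<And>u. u \<in> lattice d \<Longrightarrow>
    \<exists>H. \<forall>v\<in>lattice d. \<forall>h. (climb d B)\<^sup>*\<^sup>* (v, 0) (u, h) \<longrightarrow> h \<le> H"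
  shows "\<exists>F. (\<forall>u\<in>lattice d. (u, F u) \<notin> B) \<and>
    (\<forall>u\<in>lattice d. \<forall>v\<in>lattice d. \<bar>real_of_int (F u) - real_of_int (F v)\<bar> \<le> l1_dist d u v)"
proof -
  define R where "R u h \<longleftrightarrow> (\<exists>v\<in>lattice d. (climb d B)\<^sup>*\<^sup>* (v, 0) (u, h))" for u h
  have step: "R v h'" if "R u h" "climb d B (u, h) (v, h')" for u v h h'
    using that unfolding R_def by (meson rtranclp.rtrancl_into_rtrancl)
  have "\<exists>m. R u m \<and> (\<forall>h. R u h \<longrightarrow> h \<le> m)" if u: "u \<in> lattice d" for u
  proof -
    obtain H where "\<forall>v\<in>lattice d. \<forall>h. (climb d B)\<^sup>*\<^sup>* (v, 0) (u, h) \<longrightarrow> h \<le> H"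
      using bounded[OF u] by blast
    then have "R u h \<Longrightarrow> h \<le> H" for h
      unfolding R_def by blast
    moreover have "R u 0"
      using u unfolding R_def by blast
    ultimately show ?thesis
      by (intro greatest_int)
  qed
  then obtain m where m: "\<And>u. u \<in> lattice d \<Longrightarrow> R u (m u)"
    and max: "\<And>u h. u \<in> lattice d \<Longrightarrow> R u h \<Longrightarrow> h \<le> m u"
    by metis
  have good: "(u, m u + 1) \<notin> B" if u: "u \<in> lattice d" for u
  proof
    assume "(u, m u + 1) \<in> B"
    then have "climb d B (u, m u) (u, m u + 1)"
      using u by (simp add: climb_def)
    then have "R u (m u + 1)"
      using step m[OF u] by blast
    then show False
      using max[OF u] by fastforce
  qed
  have drop: "m u - 1 \<le> m v" if u: "u \<in> lattice d" "v \<in> lattice d" "u \<in> nbrs d v" for u v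
  proof -
    have "climb d B (u, m u) (v, m u - 1)"
      using u by (simp add: climb_def)
    then show ?thesis
      using step m[OF u(1)] max[OF u(2)] by blast
  qed
  have lip: "m u \<le> m v + int n"
    if "u \<in> lattice d" "v \<in> lattice d" "\<forall>i<d. \<bar>u i - v i\<bar> \<le> int n" for u v n
    using that
  proof (induction n arbitrary: u)
    case 0
    then have "u = v"
      by (auto simp: lattice_def intro: PiE_ext)
    then show ?case by simp
  next
    case (Suc n)
    \<comment> \<open>one step from \<open>u\<close> towards \<open>v\<close> in every coordinate at once\<close>
    define w where "w = (\<lambda>i\<in>{..<d}. u i + sgn (v i - u i))"
    have w: "w \<in> lattice d"
      by (simp add: w_def lattice_def)
    have "u \<in> nbrs d w"
      unfolding nbrs_iff[OF w Suc.prems(1)] by (auto simp: w_def sgn_if)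
    moreover have "\<bar>w i - v i\<bar> \<le> int n" if "i < d" for i
      using Suc.prems(3)[rule_format, OF that] that by (auto simp: w_def sgn_if)
    ultimately show ?case
      using Suc.IH[OF w Suc.prems(2)] drop[OF Suc.prems(1) w] by simp
  qed
  have "m u - m v \<le> (\<Sum>i<d. \<bar>u i - v i\<bar>)" if uv: "u \<in> lattice d" "v \<in> lattice d" for u v
  proof -
    let ?n = "nat (\<Sum>i<d. \<bar>u i - v i\<bar>)"
    have "\<bar>u i - v i\<bar> \<le> (\<Sum>i<d. \<bar>u i - v i\<bar>)" if "i < d" for i
      using that by (intro member_le_sum) auto
    moreover have n: "int ?n = (\<Sum>i<d. \<bar>u i - v i\<bar>)"
      by (simp add: sum_nonneg)
    ultimately have "m u \<le> m v + int ?n"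
      using lip[OF uv, of ?n] by simp
    then show ?thesis unfolding n by simp
  qed
  then have le: "real_of_int (m u - m v) \<le> l1_dist d u v" if "u \<in> lattice d" "v \<in> lattice d" for u v
    using that of_int_le_iff[of "m u - m v" "\<Sum>i<d. \<bar>u i - v i\<bar>", where 'a=real]
    by (simp add: l1_dist_def)
  have "\<bar>real_of_int (m u + 1) - real_of_int (m v + 1)\<bar> \<le> l1_dist d u v"
    if "u \<in> lattice d" "v \<in> lattice d" for u v
    using le[OF that] le[OF that(2,1)] Metric_space.commute[OF Metric_space_lattice, of d u v]
    by (simp add: abs_le_iff)
  with good show ?thesis
    by (intro exI[of _ "\<lambda>u. m u + 1"]) blast
qed

section \<open>Counting climbing paths\<close>

text \<open>The cells that a path enters by a rising step. All of them lie in \<open>B\<close>, and in a path without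
repetitions their number determines the height gained.\<close>

fun rises :: "cell \<Rightarrow> cell list \<Rightarrow> cell set" where
  "rises x [] = {}"
| "rises x (y # ys) = (if snd y = snd x + 1 then insert y (rises y ys) else rises y ys)"

lemma rises_subset: "rises x xs \<subseteq> set xs"
  by (induction x xs rule: rises.induct) auto

lemma finite_rises: "finite (rises x xs)"
  by (rule finite_subset[OF rises_subset]) simp

lemma rises_of_path:
  assumes "rtrancl_path (climb d B) x xs z" "distinct (x # xs)"
  shows "rises x xs \<subseteq> B \<inter> lattice d \<times> UNIV \<and>
    2 * int (card (rises x xs)) = int (length xs) + snd z - snd x"
  using assms
proof (induction rule: rtrancl_path.induct)
  case (step x y ys z)
  then have IH: "rises y ys \<subseteq> B \<inter> lattice d \<times> UNIV"
    "2 * int (card (rises y ys)) = int (length ys) + snd z - snd y"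
    by simp_all
  have "y \<notin> rises y ys"
    using rises_subset[of y ys] step.prems by auto
  then have card: "card (insert y (rises y ys)) = Suc (card (rises y ys))"
    by (simp add: finite_rises)
  show ?case
  proof (cases "snd y = snd x + 1")
    case True
    then have "y \<in> B \<inter> lattice d \<times> UNIV"
      using step.hyps(1) by (cases y) (simp add: climb_def)
    with True IH card show ?thesis by simp
  next
    case False
    then have "snd y = snd x - 1"
      using step.hyps(1) by (simp add: climb_def)
    with IH show ?thesis by simp
  qed
qed simp

text \<open>With \<open>UNIV\<close> for the set of cells, this is a fixed family of paths that does not depend on the
configuration. The starting point is left open, and counting is done backwards from the end.\<close>

definition paths :: "nat \<Rightarrow> nat \<Rightarrow> cell \<Rightarrow> (cell \<times> cell list) set" where
  "paths d L z = {(x, xs). rtrancl_path (climb d UNIV) x xs z \<and> length xs = L}"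

lemma finite_card_paths: "finite (paths d L z) \<and> card (paths d L z) \<le> (3 ^ d + 1) ^ L"
proof (induction L)
  case 0
  have "paths d 0 z \<subseteq> {(z, [])}"
    by (auto simp: paths_def elim: rtrancl_path.cases)
  then show ?case
    using card_mono[of "{(z, [])}" "paths d 0 z"] by (auto intro: finite_subset)
next
  case (Suc L)
  define preds where "preds y = insert (fst y, snd y - 1) ((\<lambda>v. (v, snd y + 1)) ` nbrs d (fst y))"
    for y :: cell
  have fin: "finite (preds y)" for y
    by (simp add: preds_def finite_nbrs)
  have card: "card (preds y) \<le> 3 ^ d + 1" for y
  proof -
    have "card (preds y) \<le> Suc (card ((\<lambda>v. (v, snd y + 1)) ` nbrs d (fst y)))"
      unfolding preds_def by (rule card_insert_le_m1) auto
    also have "\<dots> \<le> Suc (card (nbrs d (fst y)))"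
      by (simp add: card_image_le finite_nbrs)
    finally show ?thesis
      using card_nbrs[of d "fst y"] by simp
  qed
  let ?ext = "\<lambda>q. (\<lambda>x. (x, fst q # snd q)) ` preds (fst q)"
  have sub: "paths d (Suc L) z \<subseteq> (\<Union>q\<in>paths d L z. ?ext q)"
  proof
    fix q assume "q \<in> paths d (Suc L) z"
    then obtain x y ys where q: "q = (x, y # ys)" "rtrancl_path (climb d UNIV) x (y # ys) z" "length ys = L"
      by (auto simp: paths_def length_Suc_conv)
    from q(2) have "climb d UNIV x y" and path: "rtrancl_path (climb d UNIV) y ys z"
      by (auto elim: rtrancl_path.cases)
    then have "x \<in> preds y"
      by (cases x) (auto simp: climb_def preds_def)
    moreover have "(y, ys) \<in> paths d L z"
      using path q(3) by (simp add: paths_def)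
    ultimately show "q \<in> (\<Union>q\<in>paths d L z. ?ext q)"
      unfolding q(1) by force
  qed
  have fin_un: "finite (\<Union>q\<in>paths d L z. ?ext q)"
    using Suc fin by blast
  have "card (paths d (Suc L) z) \<le> card (\<Union>q\<in>paths d L z. ?ext q)"
    by (rule card_mono[OF fin_un sub])
  also have "\<dots> \<le> (\<Sum>q\<in>paths d L z. card (?ext q))"
    using Suc by (intro card_UN_le) blast
  also have "\<dots> \<le> (\<Sum>q\<in>paths d L z. 3 ^ d + 1)"
    by (intro sum_mono order_trans[OF card_image_le card] fin)
  also have "\<dots> = card (paths d L z) * (3 ^ d + 1)"
    by simp
  also have "\<dots> \<le> (3 ^ d + 1) ^ L * (3 ^ d + 1)"
    using Suc by (intro mult_right_mono) simp_all
  also have "\<dots> = (3 ^ d + 1) ^ Suc L"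
    by (simp only: power_Suc2)
  finally show ?case
    using finite_subset[OF sub fin_un] by blast
qed

section \<open>Coarse embeddings into the open sites in dimension less than D\<close>

text \<open>Site number \<open>j\<close> of the column of \<open>n\<close> consecutive sites in direction \<open>d\<close> that belongs to the cell \<open>c\<close>.
Columns of different cells are disjoint; the coordinates beyond \<open>d\<close> are zero.\<close>

definition cell_site :: "nat \<Rightarrow> nat \<Rightarrow> nat \<Rightarrow> cell \<Rightarrow> int \<Rightarrow> (nat \<Rightarrow> int)" where
  "cell_site D d n c j =
     (\<lambda>i\<in>{..<D}. if i < d then fst c i else if i = d then int n * snd c + j else 0)"

definition blocked :: "nat \<Rightarrow> nat \<Rightarrow> nat \<Rightarrow> ((nat \<Rightarrow> int) \<Rightarrow> bool) \<Rightarrow> cell set" where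
  "blocked D d n \<omega> = {c. \<forall>j\<in>{0..<int n}. \<not> \<omega> (cell_site D d n c j)}"

lemma cell_site_in_lattice: "cell_site D d n c j \<in> lattice D"
  by (simp add: cell_site_def lattice_def)

lemma inj_on_cell_site:
  assumes dD: "d < D"
  shows "inj_on (\<lambda>(c, j). cell_site D d n c j) ((lattice d \<times> UNIV) \<times> {0..<int n})"
proof (rule inj_onI)
  fix x y
  assume x: "x \<in> (lattice d \<times> UNIV) \<times> {0..<int n}" and y: "y \<in> (lattice d \<times> UNIV) \<times> {0..<int n}"
    and eq': "(\<lambda>(c, j). cell_site D d n c j) x = (\<lambda>(c, j). cell_site D d n c j) y"
  obtain u h j u' h' j' where xy: "x = ((u, h), j)" "y = ((u', h'), j')"
    by (metis surj_pair)
  have u: "u \<in> lattice d" "u' \<in> lattice d" and j: "j \<in> {0..<int n}" "j' \<in> {0..<int n}"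
    and eq: "cell_site D d n (u, h) j = cell_site D d n (u', h') j'"
    using x y eq' by (simp_all add: xy)
  have "u i = u' i" if "i < d" for i
    using fun_cong[OF eq, of i] that dD by (simp add: cell_site_def)
  then have "u = u'"
    using u by (auto simp: lattice_def intro: PiE_ext)
  have t: "int n * h + j = int n * h' + j'"
    using fun_cong[OF eq, of d] dD by (simp add: cell_site_def)
  have "(int n * h + j) div int n = h" "(int n * h' + j') div int n = h'"
    using j by simp_all
  with t have "h = h'" by simp
  with t \<open>u = u'\<close> show "x = y" by (simp add: xy)
qed

lemma l1_dist_cell_site:
  assumes dD: "d < D"
  shows "l1_dist D (cell_site D d n (u, h) j) (cell_site D d n (v, h') j')
    = l1_dist d u v + \<bar>(real n * of_int h + of_int j) - (real n * of_int h' + of_int j')\<bar>"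
proof -
  let ?a = "\<lambda>i. if i < d then \<bar>real_of_int (u i) - real_of_int (v i)\<bar>
    else if i = d then \<bar>(real n * of_int h + of_int j) - (real n * of_int h' + of_int j')\<bar> else 0"
  have "l1_dist D (cell_site D d n (u, h) j) (cell_site D d n (v, h') j') = (\<Sum>i<D. ?a i)"
    unfolding l1_dist_def by (intro sum.cong) (auto simp: cell_site_def)
  also have "\<dots> = (\<Sum>i<Suc d. ?a i)"
    using dD by (intro sum.mono_neutral_right) auto
  also have "\<dots> = (\<Sum>i<d. ?a i) + \<bar>(real n * of_int h + of_int j) - (real n * of_int h' + of_int j')\<bar>"
    by simp
  also have "(\<Sum>i<d. ?a i) = l1_dist d u v"
    unfolding l1_dist_def by (intro sum.cong) auto
  finally show ?thesis .
qed

lemma prob_blocked: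
  assumes p: "0 \<le> p" "p \<le> 1" and dD: "d < D" and X: "finite X" "X \<subseteq> lattice d \<times> UNIV"
  defines "M \<equiv> site_percolation D p"
  shows "{\<omega> \<in> space M. X \<subseteq> blocked D d n \<omega>} \<in> sets M"
    and "measure M {\<omega> \<in> space M. X \<subseteq> blocked D d n \<omega>} = (1 - p) ^ (n * card X)"
proof -
  let ?S = "(\<lambda>(c, j). cell_site D d n c j) ` (X \<times> {0..<int n})"
  have S: "finite ?S" "?S \<subseteq> lattice D"
    using X(1) cell_site_in_lattice by auto
  have "inj_on (\<lambda>(c, j). cell_site D d n c j) (X \<times> {0..<int n})"
    by (rule inj_on_subset[OF inj_on_cell_site[OF dD]]) (use X(2) in blast)
  then have card: "card ?S = n * card X"
    by (simp add: card_image card_cartesian_product)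
  have eq: "{\<omega> \<in> space M. X \<subseteq> blocked D d n \<omega>} = {\<omega> \<in> space M. \<forall>x\<in>?S. \<not> \<omega> x}"
    by (auto simp: blocked_def)
  show "{\<omega> \<in> space M. X \<subseteq> blocked D d n \<omega>} \<in> sets M"
    unfolding eq unfolding M_def by (rule sets_all_closed[OF S])
  show "measure M {\<omega> \<in> space M. X \<subseteq> blocked D d n \<omega>} = (1 - p) ^ (n * card X)"
    unfolding eq unfolding M_def prob_all_closed[OF p S] card ..
qed

text \<open>A Peierls estimate. A path of length \<open>L\<close> that ends at a height \<open>h \<ge> 0\<close> rises at least \<open>L / 2\<close> times, into
distinct blocked cells, which has probability at most \<open>(1 - p) powr (n * L / 2)\<close>. There are at most
\<open>(L + 1) * (3 ^ d + 1) ^ L\<close> such paths above \<open>u\<close> with \<open>h \<le> L\<close>. For large \<open>n\<close> the sum over \<open>L\<close> converges,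
so by Borel and Cantelli only finitely many lengths occur, and the length bounds the height.\<close>

lemma AE_climb_bounded:
  assumes p: "0 < p" "p < 1" and dD: "d < D"
    and n: "real (3 ^ d + 1) * sqrt (1 - p) ^ n \<le> 1 / 4"
    and u: "u \<in> lattice d"
  shows "AE \<omega> in site_percolation D p.
    \<exists>H. \<forall>v\<in>lattice d. \<forall>h. (climb d (blocked D d n \<omega>))\<^sup>*\<^sup>* (v, 0) (u, h) \<longrightarrow> h \<le> H"
proof -
  let ?M = "site_percolation D p"
  interpret prob_space ?M
    by (rule prob_space_site_percolation)
  let ?s = "sqrt (1 - p)" and ?K = "3 ^ d + 1 :: nat"
  have s: "0 \<le> ?s" "?s \<le> 1" "?s ^ 2 = 1 - p"
    using p by auto
  define Q where "Q L = (\<Union>h\<in>{0..int L}. {(x, xs) \<in> paths d L (u, h).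
      rises x xs \<subseteq> lattice d \<times> UNIV \<and> L \<le> 2 * card (rises x xs)})" for L
  define A where "A L = (\<Union>(x, xs)\<in>Q L. {\<omega> \<in> space ?M. rises x xs \<subseteq> blocked D d n \<omega>})" for L
  have finQ: "finite (Q L)" for L
    unfolding Q_def
  proof (intro finite_UN_I)
    fix h
    show "finite {(x, xs) \<in> paths d L (u, h). rises x xs \<subseteq> lattice d \<times> UNIV \<and> L \<le> 2 * card (rises x xs)}"
      by (rule finite_subset[OF _ conjunct1[OF finite_card_paths]]) auto
  qed simp
  have cardQ: "card (Q L) \<le> (L + 1) * ?K ^ L" for L
  proof -
    let ?P = "\<lambda>h. {(x, xs) \<in> paths d L (u, h). rises x xs \<subseteq> lattice d \<times> UNIV \<and> L \<le> 2 * card (rises x xs)}"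
    have "card (Q L) \<le> (\<Sum>h\<in>{0..int L}. card (?P h))"
      unfolding Q_def by (rule card_UN_le) simp
    also have "\<dots> \<le> (\<Sum>h\<in>{0..int L}. ?K ^ L)"
    proof (rule sum_mono)
      fix h
      have "card (?P h) \<le> card (paths d L (u, h))"
        by (rule card_mono[OF conjunct1[OF finite_card_paths]]) auto
      then show "card (?P h) \<le> ?K ^ L"
        using finite_card_paths[of d L "(u, h)"] by linarith
    qed
    also have "\<dots> = card {0..int L} * ?K ^ L"
      by (simp only: sum_constant of_nat_id)
    also have "card {0..int L} = L + 1"
      by (simp add: nat_add_distrib)
    finally show ?thesis .
  qed
  have inQ: "rises x xs \<subseteq> lattice d \<times> UNIV" "L \<le> 2 * card (rises x xs)" if "(x, xs) \<in> Q L" for x xs L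
    using that unfolding Q_def by auto
  have meas: "{\<omega> \<in> space ?M. rises x xs \<subseteq> blocked D d n \<omega>} \<in> sets ?M" if "(x, xs) \<in> Q L" for x xs L
    using p by (intro prob_blocked dD finite_rises inQ(1)[OF that]) auto
  have A: "A L \<in> sets ?M" for L
    unfolding A_def by (rule sets.finite_UN[OF finQ]) (use meas in auto)
  have path_bound: "measure ?M {\<omega> \<in> space ?M. rises x xs \<subseteq> blocked D d n \<omega>} \<le> (?s ^ n) ^ L"
    if "(x, xs) \<in> Q L" for x xs L
  proof -
    have "measure ?M {\<omega> \<in> space ?M. rises x xs \<subseteq> blocked D d n \<omega>} = (1 - p) ^ (n * card (rises x xs))"
      using p by (intro prob_blocked dD finite_rises inQ(1)[OF that]) auto
    also have "\<dots> = (?s ^ 2) ^ (n * card (rises x xs))"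
      by (simp only: s(3))
    also have "\<dots> = ?s ^ (n * (2 * card (rises x xs)))"
      by (simp only: power_mult[symmetric] mult.left_commute)
    also have "\<dots> \<le> ?s ^ (n * L)"
      using inQ(2)[OF that] s by (intro power_decreasing) simp_all
    finally show ?thesis by (simp add: power_mult)
  qed
  have bound: "measure ?M (A L) \<le> (1 / 2) ^ L" for L
  proof -
    have "measure ?M (A L) \<le> (\<Sum>q\<in>Q L. measure ?M (case q of (x, xs) \<Rightarrow> {\<omega> \<in> space ?M. rises x xs \<subseteq> blocked D d n \<omega>}))"
      unfolding A_def by (rule finite_measure_subadditive_finite[OF finQ]) (use meas in auto)
    also have "\<dots> \<le> (\<Sum>q\<in>Q L. (?s ^ n) ^ L)"
      by (rule sum_mono) (use path_bound in auto)
    also have "\<dots> = real (card (Q L)) * (?s ^ n) ^ L"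
      by simp
    also have "\<dots> \<le> real ((L + 1) * ?K ^ L) * (?s ^ n) ^ L"
      using cardQ[of L] s(1) by (intro mult_right_mono) (simp_all only: of_nat_le_iff zero_le_power)
    also have "\<dots> = real (L + 1) * (real ?K * ?s ^ n) ^ L"
      by (simp only: power_mult_distrib of_nat_mult of_nat_power mult.assoc)
    also have "\<dots> \<le> 2 ^ L * (1 / 4) ^ L"
    proof (intro mult_mono power_mono n)
      have "real (Suc L) \<le> real (2 ^ L)"
        unfolding of_nat_le_iff by (rule Suc_leI) (rule less_exp)
      then show "real (L + 1) \<le> 2 ^ L" by simp
    qed (use s(1) in simp_all)
    also have "\<dots> = (1 / 2) ^ L"
      by (simp flip: power_mult_distrib)
    finally show ?thesis .
  qed
  have "summable (\<lambda>L. measure ?M (A L))"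
  proof (rule summable_comparison_test')
    show "summable (\<lambda>L. (1 / 2 :: real) ^ L)"
      by (rule summable_geometric) simp
    show "norm (measure ?M (A L)) \<le> (1 / 2) ^ L" if "L \<ge> 0" for L
      using bound by simp
  qed
  then have "AE \<omega> in ?M. eventually (\<lambda>L. \<omega> \<in> space ?M - A L) sequentially"
    by (rule borel_cantelli_AE1[OF A, rotated]) (simp add: emeasure_eq_measure)
  then show ?thesis
  proof (rule AE_mp[OF _ AE_I2], intro impI)
    fix \<omega> assume \<omega>: "\<omega> \<in> space ?M" and "\<forall>\<^sub>F L in sequentially. \<omega> \<in> space ?M - A L"
    then obtain N where N: "\<And>L. N \<le> L \<Longrightarrow> \<omega> \<notin> A L"
      unfolding eventually_sequentially by blast
    have "h \<le> int N" if v: "v \<in> lattice d" and h: "(climb d (blocked D d n \<omega>))\<^sup>*\<^sup>* (v, 0) (u, h)" for v h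
    proof (rule ccontr)
      assume "\<not> h \<le> int N"
      let ?B = "blocked D d n \<omega>"
      obtain xs0 where "rtrancl_path (climb d ?B) (v, 0) xs0 (u, h)"
        using h unfolding rtranclp_eq_rtrancl_path by blast
      then obtain xs where xs: "rtrancl_path (climb d ?B) (v, 0) xs (u, h)" "distinct ((v, 0) # xs)"
        by (rule rtrancl_path_distinct)
      let ?x = "(v, 0) :: cell"
      have rises: "rises ?x xs \<subseteq> ?B \<inter> lattice d \<times> UNIV"
        "2 * int (card (rises ?x xs)) = int (length xs) + h"
        using rises_of_path[OF xs] by simp_all
      have "card (rises ?x xs) \<le> length xs"
        using card_mono[OF _ rises_subset[of ?x xs]] card_length[of xs] by simp
      then have hL: "h \<le> int (length xs)"
        using rises(2) by linarith
      have "rtrancl_path (climb d UNIV) ?x xs (u, h)"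
        using xs(1) by (rule rtrancl_path_mono) (auto simp: climb_def)
      then have "(?x, xs) \<in> paths d (length xs) (u, h)"
        by (simp add: paths_def)
      then have "(?x, xs) \<in> Q (length xs)"
        using rises hL \<open>\<not> h \<le> int N\<close> unfolding Q_def by (intro UN_I[of h]) auto
      then have "\<omega> \<in> A (length xs)"
        unfolding A_def using rises(1) \<omega> by blast
      moreover have "N \<le> length xs"
        using hL \<open>\<not> h \<le> int N\<close> by linarith
      ultimately show False
        using N by blast
    qed
    then show "\<exists>H. \<forall>v\<in>lattice d. \<forall>h. (climb d (blocked D d n \<omega>))\<^sup>*\<^sup>* (v, 0) (u, h) \<longrightarrow> h \<le> H"
      by blast
  qed
qed

text \<open>Every base point is sent to an open site in the column on the surface above it. The base
coordinates alone give the lower bound on distances, the Lipschitz property the upper bound.\<close>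

lemma coarse_embedding_of_surface:
  assumes dD: "d < D"
    and bounded: "\<And>u. u \<in> lattice d \<Longrightarrow>
      \<exists>H. \<forall>v\<in>lattice d. \<forall>h. (climb d (blocked D d n \<omega>))\<^sup>*\<^sup>* (v, 0) (u, h) \<longrightarrow> h \<le> H"
  shows "\<exists>f. coarse_embedding d D (real (n + 1)) f \<and> (\<forall>u\<in>lattice d. \<omega> (f u))"
proof -
  obtain F where F: "\<And>u. u \<in> lattice d \<Longrightarrow> (u, F u) \<notin> blocked D d n \<omega>"
    and lip: "\<And>u v. u \<in> lattice d \<Longrightarrow> v \<in> lattice d \<Longrightarrow>
      \<bar>real_of_int (F u) - real_of_int (F v)\<bar> \<le> l1_dist d u v"
    using lipschitz_surface[OF bounded] by blast
  then have "\<exists>j. j \<in> {0..<int n} \<and> \<omega> (cell_site D d n (u, F u) j)" if "u \<in> lattice d" for u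
    using that unfolding blocked_def by blast
  then obtain j where j: "\<And>u. u \<in> lattice d \<Longrightarrow> j u \<in> {0..<int n}"
    and op: "\<And>u. u \<in> lattice d \<Longrightarrow> \<omega> (cell_site D d n (u, F u) (j u))"
    by metis
  define f where "f u = cell_site D d n (u, F u) (j u)" for u
  have "comparable_up_to (real (n + 1)) (l1_dist d u v) (l1_dist D (f u) (f v))"
    if u: "u \<in> lattice d" "v \<in> lattice d" for u v
  proof -
    let ?r = "l1_dist d u v" and ?s = "l1_dist D (f u) (f v)"
    let ?t = "\<bar>(real n * of_int (F u) + of_int (j u)) - (real n * of_int (F v) + of_int (j v))\<bar>"
    have s: "?s = ?r + ?t"
      unfolding f_def by (rule l1_dist_cell_site[OF dD])
    have "?t = \<bar>real n * (real_of_int (F u) - real_of_int (F v)) + (real_of_int (j u) - real_of_int (j v))\<bar>"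
      by (simp add: algebra_simps)
    also have "\<dots> \<le> \<bar>real n * (real_of_int (F u) - real_of_int (F v))\<bar> + \<bar>real_of_int (j u) - real_of_int (j v)\<bar>"
      by (rule abs_triangle_ineq)
    also have "\<bar>real n * (real_of_int (F u) - real_of_int (F v))\<bar> = real n * \<bar>real_of_int (F u) - real_of_int (F v)\<bar>"
      by (simp add: abs_mult)
    also have "real n * \<bar>real_of_int (F u) - real_of_int (F v)\<bar> + \<bar>real_of_int (j u) - real_of_int (j v)\<bar>
        \<le> real n * ?r + real n"
    proof (intro add_mono mult_left_mono lip[OF u])
      have "\<bar>j u - j v\<bar> \<le> int n"
        using j[OF u(1)] j[OF u(2)] by auto
      then show "\<bar>real_of_int (j u) - real_of_int (j v)\<bar> \<le> real n"
        by linarith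
    qed simp
    finally have "?t \<le> real n * ?r + real n" .
    then have "?s \<le> real (n + 1) * ?r + real (n + 1)"
      unfolding s by (simp add: algebra_simps)
    moreover have "?r \<le> ?s"
      unfolding s by simp
    moreover have "?s \<le> real (n + 1) * ?s + real (n + 1)"
      by (simp add: algebra_simps)
    ultimately show ?thesis
      unfolding comparable_up_to_def by linarith
  qed
  then show ?thesis
    using op cell_site_in_lattice
    by (intro exI[of _ f]) (auto simp: coarse_embedding_def f_def)
qed

lemma AE_qi_event:
  assumes p: "0 < p" "p < 1" and dD: "d < D"
  shows "AE \<omega> in site_percolation D p. \<omega> \<in> qi_event d D p"
proof -
  let ?s = "sqrt (1 - p)"
  have "(\<lambda>n. real (3 ^ d + 1) * ?s ^ n) \<longlonglongrightarrow> real (3 ^ d + 1) * 0"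
    using p by (intro tendsto_mult_left LIMSEQ_power_zero) auto
  then have "\<forall>\<^sub>F n in sequentially. real (3 ^ d + 1) * ?s ^ n < 1 / 4"
    by (rule order_tendstoD) simp
  then obtain n where n: "real (3 ^ d + 1) * ?s ^ n < 1 / 4"
    by (auto simp: eventually_sequentially)
  have "AE \<omega> in site_percolation D p. \<forall>u\<in>lattice d.
    \<exists>H. \<forall>v\<in>lattice d. \<forall>h. (climb d (blocked D d n \<omega>))\<^sup>*\<^sup>* (v, 0) (u, h) \<longrightarrow> h \<le> H"
    unfolding AE_ball_countable[OF countable_lattice]
    using AE_climb_bounded[OF p dD less_imp_le[OF n]] by blast
  then show ?thesis
  proof (rule AE_mp, intro AE_I2 impI)
    fix \<omega> assume \<omega>: "\<omega> \<in> space (site_percolation D p)"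
      and "\<forall>u\<in>lattice d. \<exists>H. \<forall>v\<in>lattice d. \<forall>h.
        (climb d (blocked D d n \<omega>))\<^sup>*\<^sup>* (v, 0) (u, h) \<longrightarrow> h \<le> H"
    then have "\<exists>f. coarse_embedding d D (real (n + 1)) f \<and> (\<forall>u\<in>lattice d. \<omega> (f u))"
      by (intro coarse_embedding_of_surface[OF dD]) blast
    with \<omega> show "\<omega> \<in> qi_event d D p"
      unfolding qi_event_iff by blast
  qed
qed

section \<open>Coarse self-embeddings of a lattice are coarsely onto\<close>

text \<open>Vectors of dimension \<open>n\<close> are functions on the naturals whose first \<open>n\<close> coordinates matter, in the
style of \<open>Euclidean_space n\<close>, which lets the dimension be a number instead of a type.\<close>

definition l1_norm :: "nat \<Rightarrow> (nat \<Rightarrow> real) \<Rightarrow> real" where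
  "l1_norm n v = (\<Sum>i<n. \<bar>v i\<bar>)"

lemma l1_norm_nonneg [simp]: "0 \<le> l1_norm n v"
  unfolding l1_norm_def by (intro sum_nonneg) auto

lemma component_le_l1_norm: "i < n \<Longrightarrow> \<bar>v i\<bar> \<le> l1_norm n v"
  unfolding l1_norm_def by (rule member_le_sum) auto

text \<open>By invariance of domain the image of \<open>g\<close> is open. If the image of the origin is nonzero, the image
therefore contains a point a little further along the segment from \<open>g 0\<close> to the origin.\<close>

lemma bilipschitz_no_closest_point:
  fixes g :: "(nat \<Rightarrow> real) \<Rightarrow> (nat \<Rightarrow> real)"
  assumes k: "0 < k"
    and upper: "\<And>v w. l1_norm D (\<lambda>i. g v i - g w i) \<le> k * l1_norm D (\<lambda>i. v i - w i)"
    and lower: "\<And>v w. l1_norm D (\<lambda>i. v i - w i) \<le> k * l1_norm D (\<lambda>i. g v i - g w i)"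
    and pos: "0 < l1_norm D (g (\<lambda>_. 0))"
  shows "\<exists>v. l1_norm D (g v) < l1_norm D (g (\<lambda>_. 0))"
proof -
  let ?E = "Euclidean_space D"
  define h where "h v = (\<lambda>i. if i < D then g v i else 0)" for v
  have norm_h: "l1_norm D (h v) = l1_norm D (g v)" for v
    by (simp add: l1_norm_def h_def)
  have cont: "continuous_map (powertop_real UNIV) euclideanreal (\<lambda>v. g v i)" if i: "i < D" for i
  proof -
    have "((\<lambda>w. g w i) \<longlongrightarrow> g v i) (at v)" for v
    proof (rule Lim_null[THEN iffD2], rule Lim_null_comparison)
      show "\<forall>\<^sub>F w in at v. norm (g w i - g v i) \<le> k * l1_norm D (\<lambda>i. w i - v i)"
        using order_trans[OF component_le_l1_norm[OF i] upper] by simp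
      have "((\<lambda>w. w j) \<longlongrightarrow> v j) (at v)" for j
        using continuous_on_product_coordinates[of j] by (auto simp: continuous_on_def)
      then have "((\<lambda>w. k * (\<Sum>j<D. \<bar>w j - v j\<bar>)) \<longlongrightarrow> k * (\<Sum>j<D. \<bar>v j - v j\<bar>)) (at v)"
        by (intro tendsto_intros)
      then show "((\<lambda>w. k * l1_norm D (\<lambda>i. w i - v i)) \<longlongrightarrow> 0) (at v)"
        by (simp add: l1_norm_def)
    qed
    then have "continuous_on UNIV (\<lambda>v. g v i)"
      by (simp add: continuous_on_def)
    then show ?thesis
      by (simp add: euclidean_product_topology)
  qed
  have "continuous_map ?E ?E h"
    unfolding h_def continuous_map_componentwise_Euclidean_space
    using cont unfolding Euclidean_space_def by (blast intro: continuous_map_from_subtopology)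
  then have cm: "continuous_map (subtopology ?E (topspace ?E)) ?E h"
    by (simp only: subtopology_topspace)
  have inj: "inj_on h (topspace ?E)"
  proof (rule inj_onI)
    fix v w assume vw: "v \<in> topspace ?E" "w \<in> topspace ?E" "h v = h w"
    have "g v i - g w i = 0" if "i < D" for i
      using fun_cong[OF vw(3), of i] that by (simp add: h_def)
    then have "l1_norm D (\<lambda>i. g v i - g w i) = 0"
      by (simp add: l1_norm_def)
    with lower[of v w] have le: "l1_norm D (\<lambda>i. v i - w i) \<le> 0"
      by simp
    show "v = w"
    proof
      fix i show "v i = w i"
        using component_le_l1_norm[of i D "\<lambda>i. v i - w i"] le vw(1,2)
        by (cases "i < D") (auto simp: topspace_Euclidean_space)
    qed
  qed
  have "openin ?E (h ` topspace ?E)"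
    by (rule invariance_of_domain_Euclidean_space[OF openin_topspace cm inj])
  then obtain T where T: "openin (powertop_real UNIV) T" "h ` topspace ?E = T \<inter> topspace ?E"
    unfolding Euclidean_space_def openin_subtopology by auto
  have "open T"
    using T(1) by (simp add: euclidean_product_topology)
  let ?z = "\<lambda>_::nat. 0::real"
  let ?ray = "\<lambda>t::real. \<lambda>i. (1 - t) * h ?z i"
  have "continuous_on UNIV ?ray"
    by (intro continuous_on_coordinatewise_then_product continuous_intros)
  with \<open>open T\<close> have "open (?ray -` T)"
    by (rule open_vimage)
  moreover have "h ?z \<in> T"
    using T(2) by (auto simp: topspace_Euclidean_space)
  then have "0 \<in> ?ray -` T" by simp
  ultimately obtain e where e: "e > 0" "\<And>t. dist t 0 < e \<Longrightarrow> t \<in> ?ray -` T"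
    unfolding open_dist by blast
  define t where "t = min (e / 2) (1 / 2)"
  have t: "0 < t" "t < 1" "?ray t \<in> T"
    using e(1) e(2)[of t] by (auto simp: t_def dist_real_def)
  have "?ray t \<in> topspace ?E"
    by (simp add: topspace_Euclidean_space h_def)
  with T(2) t(3) obtain v where v: "h v = ?ray t"
    by (metis IntI imageE)
  have "l1_norm D (g v) = (1 - t) * l1_norm D (g ?z)"
    using t(2) unfolding norm_h[symmetric] v by (simp add: l1_norm_def abs_mult sum_distrib_left)
  also have "\<dots> < l1_norm D (g ?z)"
    using t(1) pos by (simp add: algebra_simps)
  finally show ?thesis by blast
qed

text \<open>A cluster point of the sequence, described by the closed properties that it inherits. This form
spares the extraction of subsequences and applies in the non-metrizable product below.\<close>

lemma compact_sequence_cluster_point: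
  assumes "compact K" and "\<And>n::nat. X n \<in> K"
  shows "\<exists>a. \<forall>S. closed S \<longrightarrow> (\<forall>\<^sub>F n in sequentially. X n \<in> S) \<longrightarrow> a \<in> S"
proof -
  let ?F = "filtermap X sequentially"
  have "?F \<noteq> bot" "eventually (\<lambda>x. x \<in> K) ?F"
    using assms(2) by (simp_all add: filtermap_bot_iff eventually_filtermap)
  with assms(1) obtain a where a: "inf (nhds a) ?F \<noteq> bot"
    unfolding compact_filter by blast
  have "a \<in> S" if S: "closed S" "\<forall>\<^sub>F n in sequentially. X n \<in> S" for S
  proof (rule ccontr)
    assume "a \<notin> S"
    then have "eventually (\<lambda>x. x \<in> - S) (nhds a)"
      using S(1) by (intro eventually_nhds_in_open) auto
    moreover have "eventually (\<lambda>x. x \<in> S) ?F"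
      using S(2) by (simp add: eventually_filtermap)
    ultimately have "eventually (\<lambda>_. False) (inf (nhds a) ?F)"
      unfolding eventually_inf by blast
    with a show False by (simp add: trivial_limit_def)
  qed
  then show ?thesis by blast
qed

lemma compact_box_functions:
  fixes b :: "'a \<Rightarrow> real"
  shows "compact {g. \<forall>x. \<bar>g x\<bar> \<le> b x}"
proof -
  have "compactin (product_topology (\<lambda>_::'a. euclideanreal) UNIV) (Pi\<^sub>E UNIV (\<lambda>x. {- b x..b x}))"
    unfolding compactin_PiE by simp
  moreover have "Pi\<^sub>E UNIV (\<lambda>x. {- b x..b x}) = {g. \<forall>x. \<bar>g x\<bar> \<le> b x}"
    by (auto simp: PiE_iff abs_le_iff minus_le_iff)
  ultimately show ?thesis
    by (simp add: euclidean_product_topology)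
qed

lemma l1_dist_eq_nat: "l1_dist n x y = real (nat (\<Sum>i<n. \<bar>x i - y i\<bar>))"
proof -
  have "(0::int) \<le> (\<Sum>i<n. \<bar>x i - y i\<bar>)"
    by (intro sum_nonneg) auto
  then show ?thesis by (simp add: l1_dist_def)
qed

text \<open>A blow-down argument. If \<open>f\<close> misses balls around points \<open>y n\<close> of radii tending to infinity, let \<open>x n\<close>
be a point whose image is nearest to \<open>y n\<close>, at distance \<open>r n\<close>. Recentre the domain at \<open>x n\<close> and the
codomain at \<open>y n\<close> and shrink both by the factor \<open>r n\<close>. The rescaled maps \<open>H n\<close> have norm at least 1
everywhere, norm exactly 1 at the origin, and satisfy bilipschitz bounds with an additive error that
vanishes as \<open>r n\<close> grows. A pointwise cluster point is bilipschitz and has a point of its image nearest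
to the origin, at distance 1, which is impossible.\<close>

lemma coarse_self_embedding_coarsely_onto:
  assumes f: "coarse_embedding D D k f" and k: "0 < k"
  shows "\<exists>R::nat. \<forall>y\<in>lattice D. \<exists>x\<in>lattice D. l1_dist D (f x) y \<le> real R"
proof (rule ccontr)
  assume "\<not> ?thesis"
  then have "\<forall>n::nat. \<exists>y\<in>lattice D. \<forall>x\<in>lattice D. real n < l1_dist D (f x) y"
    by (simp add: not_le)
  then obtain y where y: "\<And>n. y n \<in> lattice D"
    and far: "\<And>n x. x \<in> lattice D \<Longrightarrow> real n < l1_dist D (f x) (y n)"
    by metis
  have "\<exists>x. x \<in> lattice D \<and> (\<forall>x'\<in>lattice D. l1_dist D (f x) (y n) \<le> l1_dist D (f x') (y n))" for n
    using ex_has_least_nat[of "\<lambda>x. x \<in> lattice D" _ "\<lambda>x. nat (\<Sum>i<D. \<bar>f x i - y n i\<bar>)"] lattice_nonempty[of D]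
    unfolding l1_dist_eq_nat of_nat_le_iff by blast
  then obtain x where x: "\<And>n. x n \<in> lattice D"
    and nearest: "\<And>n x'. x' \<in> lattice D \<Longrightarrow> l1_dist D (f (x n)) (y n) \<le> l1_dist D (f x') (y n)"
    by metis
  define r where "r n = l1_dist D (f (x n)) (y n)" for n
  have r: "real n < r n" for n
    unfolding r_def by (rule far[OF x])
  then have r_pos: "0 < r n" for n
    using of_nat_0_le_iff[of n, where 'a=real] by (meson le_less_trans)
  define pt where "pt n v = (\<lambda>i\<in>{..<D}. x n i + \<lfloor>r n * v i\<rfloor>)" for n and v :: "nat \<Rightarrow> real"
  have pt: "pt n v \<in> lattice D" for n v
    by (simp add: pt_def lattice_def)
  define H where "H n v i = (if i < D then (real_of_int (f (pt n v) i) - real_of_int (y n i)) / r n else 0)"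
    for n v i
  have pt0: "pt n (\<lambda>_. 0) = x n" for n
    using x[of n] by (auto simp: pt_def lattice_def PiE_iff extensional_def fun_eq_iff)
  have norm_H: "l1_norm D (H n v) = l1_dist D (f (pt n v)) (y n) / r n" for n v
    using r_pos[of n] by (simp add: l1_norm_def l1_dist_def H_def sum_divide_distrib)
  have norm_H_diff: "l1_norm D (\<lambda>i. H n v i - H n w i) = l1_dist D (f (pt n v)) (f (pt n w)) / r n" for n v w
    using r_pos[of n] by (simp add: l1_norm_def l1_dist_def H_def sum_divide_distrib flip: diff_divide_distrib)
  have dist_pt: "\<bar>l1_dist D (pt n v) (pt n w) - r n * l1_norm D (\<lambda>i. v i - w i)\<bar> \<le> D" for n v w
  proof -
    have "\<bar>\<bar>real_of_int (pt n v i) - real_of_int (pt n w i)\<bar> - r n * \<bar>v i - w i\<bar>\<bar> \<le> 1" if "i < D" for i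
    proof -
      have "\<bar>\<bar>real_of_int \<lfloor>a\<rfloor> - real_of_int \<lfloor>b\<rfloor>\<bar> - \<bar>a - b\<bar>\<bar> \<le> 1" for a b :: real
        by linarith
      from this[of "r n * v i" "r n * w i"] show ?thesis
        using that r_pos[of n] by (simp add: pt_def abs_mult flip: right_diff_distrib)
    qed
    then have "\<bar>\<Sum>i<D. \<bar>real_of_int (pt n v i) - real_of_int (pt n w i)\<bar> - r n * \<bar>v i - w i\<bar>\<bar> \<le> (\<Sum>i<D. 1)"
      by (intro order_trans[OF sum_abs] sum_mono) simp
    then show ?thesis
      by (simp add: l1_dist_def l1_norm_def sum_subtractf sum_distrib_left)
  qed
  \<comment> \<open>dominates the additive errors \<open>k * D + k\<close> and \<open>k + D\<close> of the two bounds; \<open>D\<close> comes from rounding\<close>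
  define C where "C = (k + 1) * (real D + 1)"
  have emb: "comparable_up_to k (l1_dist D (pt n v) (pt n w)) (l1_dist D (f (pt n v)) (f (pt n w)))" for n v w
    using f pt by (simp add: coarse_embedding_def)
  have H_upper: "l1_norm D (\<lambda>i. H n v i - H n w i) \<le> k * l1_norm D (\<lambda>i. v i - w i) + C / r n" for n v w
  proof -
    have "l1_dist D (f (pt n v)) (f (pt n w)) \<le> k * l1_dist D (pt n v) (pt n w) + k"
      using emb[of n v w] by (simp add: comparable_up_to_def)
    also have "\<dots> \<le> k * (r n * l1_norm D (\<lambda>i. v i - w i) + D) + k"
      using dist_pt[of n v w] k by (intro add_right_mono mult_left_mono) linarith+
    also have "\<dots> \<le> k * (r n * l1_norm D (\<lambda>i. v i - w i)) + C"
      using k by (simp add: C_def algebra_simps)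
    finally have "l1_dist D (f (pt n v)) (f (pt n w)) / r n
        \<le> (k * (r n * l1_norm D (\<lambda>i. v i - w i)) + C) / r n"
      using r_pos[of n] by (intro divide_right_mono) auto
    then show ?thesis
      using r_pos[of n] by (simp add: norm_H_diff add_divide_distrib)
  qed
  have H_lower: "l1_norm D (\<lambda>i. v i - w i) \<le> k * l1_norm D (\<lambda>i. H n v i - H n w i) + C / r n" for n v w
  proof -
    have "r n * l1_norm D (\<lambda>i. v i - w i) \<le> l1_dist D (pt n v) (pt n w) + D"
      using dist_pt[of n v w] by linarith
    also have "\<dots> \<le> (k * l1_dist D (f (pt n v)) (f (pt n w)) + k) + D"
      using emb[of n v w] by (simp add: comparable_up_to_def)
    also have "\<dots> \<le> k * l1_dist D (f (pt n v)) (f (pt n w)) + C"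
      using k by (simp add: C_def algebra_simps)
    finally have "r n * l1_norm D (\<lambda>i. v i - w i) / r n
        \<le> (k * l1_dist D (f (pt n v)) (f (pt n w)) + C) / r n"
      using r_pos[of n] by (intro divide_right_mono) auto
    then show ?thesis
      using r_pos[of n] by (simp add: norm_H_diff add_divide_distrib)
  qed
  have H0: "l1_norm D (H n (\<lambda>_. 0)) = 1" for n
    using r_pos[of n] by (simp add: norm_H pt0 r_def)
  have H_ge: "1 \<le> l1_norm D (H n v)" for n v
    using r_pos[of n] nearest[OF pt, of n n v] by (simp add: norm_H r_def)
  have C: "0 < C"
    using k by (simp add: C_def)
  have small: "C / r n \<le> e" if "C / e \<le> real n" "0 < e" for e n
  proof -
    have "C \<le> real n * e"
      using that by (simp add: divide_le_eq)
    also have "\<dots> \<le> r n * e"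
      using r[of n] that(2) by simp
    finally show ?thesis
      using r_pos[of n] by (simp add: divide_le_eq mult.commute)
  qed
  have ev: "\<forall>\<^sub>F n in sequentially. C / r n \<le> e" if "0 < e" for e
    using eventually_ge_at_top[of "nat \<lceil>C / e\<rceil>"]
  proof (rule eventually_mono)
    fix n assume "nat \<lceil>C / e\<rceil> \<le> n"
    then have "C / e \<le> real n" by linarith
    then show "C / r n \<le> e" using small that by blast
  qed
  \<comment> \<open>the shift makes the additive error at most 1 from the first term on, so that one box contains the sequence\<close>
  define X where "X n = (\<lambda>(v, i). H (n + nat \<lceil>C\<rceil>) v i)" for n
  define b where "b = (\<lambda>(v, i::nat). 1 + (k * l1_norm D v + 1))"
  have "X n \<in> {g. \<forall>z. \<bar>g z\<bar> \<le> b z}" for n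
  proof -
    define m where "m = n + nat \<lceil>C\<rceil>"
    have "C / r m \<le> 1"
      by (rule small) (use C in \<open>auto simp: m_def intro: order_trans[OF le_of_int_ceiling]\<close>)
    have "\<bar>H m v i\<bar> \<le> 1 + (k * l1_norm D v + 1)" for v i
    proof (cases "i < D")
      case True
      have "\<bar>H m v i\<bar> \<le> \<bar>H m (\<lambda>_. 0) i\<bar> + \<bar>H m v i - H m (\<lambda>_. 0) i\<bar>" by linarith
      also have "\<dots> \<le> l1_norm D (H m (\<lambda>_. 0)) + l1_norm D (\<lambda>i. H m v i - H m (\<lambda>_. 0) i)"
        using component_le_l1_norm[OF True, of "H m (\<lambda>_. 0)"]
          component_le_l1_norm[OF True, of "\<lambda>i. H m v i - H m (\<lambda>_. 0) i"] by linarith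
      also have "\<dots> \<le> 1 + (k * l1_norm D v + 1)"
        using H_upper[of m v "\<lambda>_. 0"] \<open>C / r m \<le> 1\<close> by (simp add: H0)
      finally show ?thesis .
    qed (use k in \<open>simp add: H_def\<close>)
    then show ?thesis
      by (simp add: X_def b_def m_def split_beta)
  qed
  then have "\<exists>g. \<forall>S. closed S \<longrightarrow> (\<forall>\<^sub>F n in sequentially. X n \<in> S) \<longrightarrow> g \<in> S"
    by (rule compact_sequence_cluster_point[OF compact_box_functions])
  then obtain g where "\<forall>S. closed S \<longrightarrow> (\<forall>\<^sub>F n in sequentially. X n \<in> S) \<longrightarrow> g \<in> S" ..
  then have g: "g \<in> S" if "closed S" "\<forall>\<^sub>F n in sequentially. X n \<in> S" for S
    using that by simp
  define G where "G v i = g (v, i)" for v i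
  have ev': "\<forall>\<^sub>F n in sequentially. C / r (n + nat \<lceil>C\<rceil>) \<le> e" if "0 < e" for e
    using ev[OF that] eventually_sequentially_seg[of "\<lambda>n. C / r n \<le> e" "nat \<lceil>C\<rceil>"] by simp
  have cont: "continuous_on UNIV (\<lambda>g::(nat \<Rightarrow> real) \<times> nat \<Rightarrow> real. \<Sum>i<D. \<bar>g (v, i) - g (w, i)\<bar>)"
    "continuous_on UNIV (\<lambda>g::(nat \<Rightarrow> real) \<times> nat \<Rightarrow> real. \<Sum>i<D. \<bar>g (v, i)\<bar>)" for v w
    by (intro continuous_intros continuous_on_product_coordinates)+
  have upper: "l1_norm D (\<lambda>i. G v i - G w i) \<le> k * l1_norm D (\<lambda>i. v i - w i)" for v w
  proof (rule field_le_epsilon)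
    fix e :: real assume "0 < e"
    have "g \<in> {g. (\<Sum>i<D. \<bar>g (v, i) - g (w, i)\<bar>) \<le> k * l1_norm D (\<lambda>i. v i - w i) + e}"
    proof (rule g)
      show "closed {g. (\<Sum>i<D. \<bar>g (v, i) - g (w, i)\<bar>) \<le> k * l1_norm D (\<lambda>i. v i - w i) + e}"
        by (intro closed_Collect_le cont continuous_on_const)
      show "\<forall>\<^sub>F n in sequentially. X n \<in> {g. (\<Sum>i<D. \<bar>g (v, i) - g (w, i)\<bar>) \<le> k * l1_norm D (\<lambda>i. v i - w i) + e}"
        using ev'[OF \<open>0 < e\<close>]
      proof (rule eventually_mono)
        fix n assume "C / r (n + nat \<lceil>C\<rceil>) \<le> e"
        then show "X n \<in> {g. (\<Sum>i<D. \<bar>g (v, i) - g (w, i)\<bar>) \<le> k * l1_norm D (\<lambda>i. v i - w i) + e}"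
          using H_upper[of "n + nat \<lceil>C\<rceil>" v w] by (simp add: X_def l1_norm_def)
      qed
    qed
    then show "l1_norm D (\<lambda>i. G v i - G w i) \<le> k * l1_norm D (\<lambda>i. v i - w i) + e"
      by (simp add: G_def l1_norm_def)
  qed
  have lower: "l1_norm D (\<lambda>i. v i - w i) \<le> k * l1_norm D (\<lambda>i. G v i - G w i)" for v w
  proof (rule field_le_epsilon)
    fix e :: real assume "0 < e"
    have "g \<in> {g. l1_norm D (\<lambda>i. v i - w i) \<le> k * (\<Sum>i<D. \<bar>g (v, i) - g (w, i)\<bar>) + e}"
    proof (rule g)
      show "closed {g. l1_norm D (\<lambda>i. v i - w i) \<le> k * (\<Sum>i<D. \<bar>g (v, i) - g (w, i)\<bar>) + e}"
        by (intro closed_Collect_le cont continuous_on_const continuous_on_add continuous_on_mult)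
      show "\<forall>\<^sub>F n in sequentially. X n \<in> {g. l1_norm D (\<lambda>i. v i - w i) \<le> k * (\<Sum>i<D. \<bar>g (v, i) - g (w, i)\<bar>) + e}"
        using ev'[OF \<open>0 < e\<close>]
      proof (rule eventually_mono)
        fix n assume "C / r (n + nat \<lceil>C\<rceil>) \<le> e"
        then show "X n \<in> {g. l1_norm D (\<lambda>i. v i - w i) \<le> k * (\<Sum>i<D. \<bar>g (v, i) - g (w, i)\<bar>) + e}"
          using H_lower[of v w "n + nat \<lceil>C\<rceil>"] by (simp add: X_def l1_norm_def)
      qed
    qed
    then show "l1_norm D (\<lambda>i. v i - w i) \<le> k * l1_norm D (\<lambda>i. G v i - G w i) + e"
      by (simp add: G_def l1_norm_def)
  qed
  have "g \<in> {g. 1 \<le> (\<Sum>i<D. \<bar>g (v, i)\<bar>)}" for v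
    by (rule g, intro closed_Collect_le cont continuous_on_const)
      (use H_ge in \<open>simp add: X_def l1_norm_def\<close>)
  then have G_ge: "1 \<le> l1_norm D (G v)" for v
    by (simp add: G_def l1_norm_def)
  have "g \<in> {g. (\<Sum>i<D. \<bar>g (\<lambda>_. 0, i)\<bar>) \<le> 1}"
    by (rule g, intro closed_Collect_le cont continuous_on_const)
      (use H0 in \<open>simp add: X_def l1_norm_def\<close>)
  then have "l1_norm D (G (\<lambda>_. 0)) = 1"
    using G_ge[of "\<lambda>_. 0"] by (simp add: G_def l1_norm_def)
  with bilipschitz_no_closest_point[OF k upper lower]
  obtain v where "l1_norm D (G v) < 1" by auto
  with G_ge[of v] show False by simp
qed

section \<open>No coarse embedding into the open sites in dimension at least D\<close>

definition pad :: "nat \<Rightarrow> nat \<Rightarrow> (nat \<Rightarrow> int) \<Rightarrow> (nat \<Rightarrow> int)" where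
  "pad D d x = (\<lambda>i\<in>{..<d}. if i < D then x i else 0)"

lemma pad_in_lattice: "pad D d x \<in> lattice d"
  by (simp add: pad_def lattice_def)

lemma l1_dist_pad:
  assumes "D \<le> d"
  shows "l1_dist d (pad D d x) (pad D d y) = l1_dist D x y"
proof -
  have "l1_dist d (pad D d x) (pad D d y) = (\<Sum>i<d. if i < D then \<bar>real_of_int (x i) - real_of_int (y i)\<bar> else 0)"
    unfolding l1_dist_def by (intro sum.cong) (auto simp: pad_def)
  also have "\<dots> = (\<Sum>i<D. if i < D then \<bar>real_of_int (x i) - real_of_int (y i)\<bar> else 0)"
    using assms by (intro sum.mono_neutral_right) auto
  also have "\<dots> = l1_dist D x y"
    unfolding l1_dist_def by (intro sum.cong) auto
  finally show ?thesis .
qed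

text \<open>Restricting \<open>f\<close> to a coordinate sublattice of dimension \<open>D\<close> reduces the claim to equal dimensions.\<close>

lemma coarse_embedding_meets_balls:
  assumes Dd: "D \<le> d" and f: "coarse_embedding d D k f"
  shows "\<exists>R::nat. \<forall>y\<in>lattice D. \<exists>x\<in>lattice d. l1_dist D y (f x) \<le> real R"
proof -
  \<comment> \<open>\<open>max\<close> only serves to make the constant positive\<close>
  have "coarse_embedding D D (max k 1) (f \<circ> pad D d)"
    unfolding coarse_embedding_def
  proof (intro conjI ballI)
    show "f \<circ> pad D d \<in> lattice D \<rightarrow> lattice D"
      using f pad_in_lattice by (auto simp: coarse_embedding_def)
    fix x y
    have "comparable_up_to k (l1_dist d (pad D d x) (pad D d y)) (l1_dist D (f (pad D d x)) (f (pad D d y)))"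
      using f pad_in_lattice by (simp add: coarse_embedding_def)
    then have "comparable_up_to k (l1_dist D x y) (l1_dist D ((f \<circ> pad D d) x) ((f \<circ> pad D d) y))"
      by (simp add: l1_dist_pad[OF Dd])
    then show "comparable_up_to (max k 1) (l1_dist D x y) (l1_dist D ((f \<circ> pad D d) x) ((f \<circ> pad D d) y))"
      by (rule comparable_up_to_mono) simp_all
  qed
  then obtain R :: nat where R: "\<And>y. y \<in> lattice D \<Longrightarrow> \<exists>x\<in>lattice D. l1_dist D ((f \<circ> pad D d) x) y \<le> real R"
    using coarse_self_embedding_coarsely_onto[of D "max k 1" "f \<circ> pad D d"]
    by (meson less_max_iff_disj zero_less_one)
  have "\<exists>x\<in>lattice d. l1_dist D y (f x) \<le> real R" if y: "y \<in> lattice D" for y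
  proof -
    obtain x where "x \<in> lattice D" "l1_dist D (f (pad D d x)) y \<le> real R"
      using R[OF y] by auto
    then show ?thesis
      using pad_in_lattice Metric_space.commute[OF Metric_space_lattice, of D y] by metis
  qed
  then show ?thesis by blast
qed

lemma AE_not_qi_event:
  assumes p: "0 < p" "p < 1" and D: "0 < D" and Dd: "D \<le> d"
  shows "AE \<omega> in site_percolation D p. \<omega> \<notin> qi_event d D p"
  using AE_closed_balls[OF p D]
proof (rule AE_mp, intro AE_I2 impI notI)
  fix \<omega>
  assume balls: "\<forall>R::nat. \<exists>y\<in>lattice D. \<forall>x\<in>lattice D. l1_dist D y x \<le> real R \<longrightarrow> \<not> \<omega> x"
    and "\<omega> \<in> qi_event d D p"
  then obtain k :: nat and f where f: "coarse_embedding d D (real k) f"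
    and op: "\<And>x. x \<in> lattice d \<Longrightarrow> \<omega> (f x)"
    unfolding qi_event_iff by blast
  obtain R :: nat where R: "\<And>y. y \<in> lattice D \<Longrightarrow> \<exists>x\<in>lattice d. l1_dist D y (f x) \<le> real R"
    using coarse_embedding_meets_balls[OF Dd f] by blast
  obtain y where y: "y \<in> lattice D" "\<And>x. x \<in> lattice D \<Longrightarrow> l1_dist D y x \<le> real R \<Longrightarrow> \<not> \<omega> x"
    using balls by blast
  obtain x where x: "x \<in> lattice d" "l1_dist D y (f x) \<le> real R"
    using R[OF y(1)] by blast
  have "f x \<in> lattice D"
    using f x(1) by (auto simp: coarse_embedding_def)
  with y(2) x op show False by blast
qed

section \<open>The zero-one dichotomy\<close>

theorem proposition5:
  fixes d D :: nat
  assumes "0 < d" and "0 < D"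
  shows "(d < D \<longrightarrow> (\<forall>p::real. 0 < p \<and> p < 1 \<longrightarrow>
            qi_event d D p \<in> sets (site_percolation D p) \<and>
            measure (site_percolation D p) (qi_event d D p) = 1)) \<and>
         (D \<le> d \<longrightarrow> (\<forall>p::real. 0 < p \<and> p < 1 \<longrightarrow>
            qi_event d D p \<in> sets (site_percolation D p) \<and>
            measure (site_percolation D p) (qi_event d D p) = 0))"
proof -
  have "measure (site_percolation D p) (qi_event d D p) = 1" if "d < D" "0 < p" "p < 1" for p
    using AE_qi_event[OF that(2,3,1)]
      prob_space.prob_eq_1[OF prob_space_site_percolation qi_event_sets] by simp
  moreover have "measure (site_percolation D p) (qi_event d D p) = 0" if "D \<le> d" "0 < p" "p < 1" for p
    using AE_not_qi_event[OF that(2,3) assms(2) that(1)]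
      prob_space.prob_eq_0[OF prob_space_site_percolation qi_event_sets] by simp
  ultimately show ?thesis
    using qi_event_sets by blast
qed

end
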